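(* Suppose $g\in H^t(\mathbb U)$, $t\ge1$, with $\min_{z\in\mathbb U}|g(z)|>0$, and assume the Riemann--Hilbert problem with jump $g$ has a unique solution of the form $\phi=1+\mathcal Cu$ with $u\in H^t(\mathbb U)$. Then for every $s\in\{0\}\cup(1/2,\infty)$ with $0\le2s<t$, there exists $N_0>0$ such that for $N>N_0$ the operator $\mathcal C^+-\mathcal M_N(g)\mathcal C^-$ is invertible on $\operatorname{ran}\mathcal P_N$, and the unique solution $u_N\in\operatorname{ran}\mathcal P_N$ of $$(\mathcal C^+-\mathcal M_N(g)\mathcal C^-)u_N=\mathcal P_N(g-1)$$ satisfies $\|u-u_N\|_s\le C_{s,t}N^{s-t}$ for a constant $C_{s,t}$ independent of $N$.
   Context: $\mathbb U=\{|z|=1\}$, positively oriented. $u\in L^2(\mathbb U)$ has Laurent coefficients $u_j$, $u(z)=\sum_ju_jz^j$; $H^s(\mathbb U)$ has norm $\|u\|_s^2=c_{|s|}\sum_j|u_j|^2\max\{1,|j|\}^{2s}$ with fixed normalization constants $c_{|s|}>0$. Cauchy operator $\mathcal Cu(z)=\frac1{2\pi i}\oint_{\mathbb U}\frac{u(z')}{z'-z}dz'$, boundary values $\mathcal C^\pm u(z)=\lim_{\epsilon\to0^+}\mathcal Cu(z(1\mp\epsilon))$, i.e. $\mathcal C^+u=\sum_{j\ge0}u_jz^j$, $\mathcal C^-u=-\sum_{j<0}u_jz^j$. The Riemann--Hilbert problem with jump $g$: find $\phi$ analytic on $\mathbb C\setminus\mathbb U$ of the form $\phi=1+\mathcal Cu$,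 $u\in L^2(\mathbb U)$, with $\phi^+=\phi^-g$ a.e. on $\mathbb U$, where $\phi^\pm(z)=\lim_{\epsilon\to0^+}\phi(z(1\mp\epsilon))$ (equivalently $\mathcal C^+u-(\mathcal C^-u)g=g-1$). $\mathcal M(g)u=gu$. For $N\ge1$, $N_-=\lfloor N/2\rfloor$, $N_+=\lfloor(N-1)/2\rfloor$, $\mathcal P_Nu=\sum_{j=-N_-}^{N_+}u_jz^j$, and $\mathcal M_N(g)=\mathcal P_N\mathcal M(g)\mathcal P_N$. *)

theory Defs
  imports "HOL-Analysis.Analysis"
begin

text \<open>Functions on the unit circle are represented by their Laurent
  coefficient sequences  u :: int => complex, u(z) = sum_j u_j z^j.\<close>

type_synonym lcoef = "int \<Rightarrow> complex"

definition in_Hs :: "real \<Rightarrow> lcoef \<Rightarrow> bool" where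
  "in_Hs s u \<longleftrightarrow>
     (\<lambda>j. (cmod (u j))\<^sup>2 * (max 1 \<bar>real_of_int j\<bar>) powr (2 * s)) summable_on UNIV"

text \<open>H^s norm with normalization constants c (c r for r = |s|).\<close>
definition Hs_norm :: "(real \<Rightarrow> real) \<Rightarrow> real \<Rightarrow> lcoef \<Rightarrow> real" where
  "Hs_norm c s u =
     sqrt (c \<bar>s\<bar> * (\<Sum>\<^sub>\<infinity>j\<in>UNIV. (cmod (u j))\<^sup>2 * (max 1 \<bar>real_of_int j\<bar>) powr (2 * s)))"

definition lval :: "lcoef \<Rightarrow> complex \<Rightarrow> complex" where
  "lval u z = (\<Sum>\<^sub>\<infinity>j\<in>UNIV. u j * z powi j)"

definition Cplus :: "lcoef \<Rightarrow> lcoef" where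
  "Cplus u = (\<lambda>j. if j \<ge> 0 then u j else 0)"

definition Cminus :: "lcoef \<Rightarrow> lcoef" where
  "Cminus u = (\<lambda>j. if j < 0 then - u j else 0)"

definition Mult :: "lcoef \<Rightarrow> lcoef \<Rightarrow> lcoef" where
  "Mult g u = (\<lambda>k. \<Sum>\<^sub>\<infinity>j\<in>UNIV. g j * u (k - j))"

definition one_c :: lcoef where
  "one_c = (\<lambda>j. if j = 0 then 1 else 0)"

definition RHP_sol :: "lcoef \<Rightarrow> lcoef \<Rightarrow> bool" where
  "RHP_sol g u \<longleftrightarrow> in_Hs 0 u \<and> Cplus u - Mult g (Cminus u) = g - one_c"

definition Nminus :: "nat \<Rightarrow> int" where "Nminus N = int (N div 2)"
definition Nplus :: "nat \<Rightarrow> int" where "Nplus N = (int N - 1) div 2"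

definition PN :: "nat \<Rightarrow> lcoef \<Rightarrow> lcoef" where
  "PN N u = (\<lambda>j. if - Nminus N \<le> j \<and> j \<le> Nplus N then u j else 0)"

definition ranPN :: "nat \<Rightarrow> lcoef set" where
  "ranPN N = range (PN N)"

definition MN :: "nat \<Rightarrow> lcoef \<Rightarrow> lcoef \<Rightarrow> lcoef" where
  "MN N g u = PN N (Mult g (PN N u))"

definition AN :: "nat \<Rightarrow> lcoef \<Rightarrow> lcoef \<Rightarrow> lcoef" where
  "AN N g v = Cplus v - MN N g (Cminus v)"

end

theory Submission
  imports Defs "HOL-Complex_Analysis.Great_Picard" "HOL-Library.Function_Algebras"
begin

text \<open>
  Let \<open>P\<close> and \<open>Q\<close> be the projections onto the modes \<open>j \<ge> 0\<close> and \<open>j < 0\<close>. The operator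
  \<open>\<C>\<^sup>+ - \<M>(g)\<C>\<^sup>- = P + gQ\<close> is block triangular with respect to them, so everything reduces to the
  stability in \<open>\<ell>\<^sup>2\<close> of the finite sections of the Toeplitz operator \<open>QgQ\<close>. Suppose that unit vectors
  \<open>v\<^sub>n\<close> supported in \<open>[-M\<^sub>n, -1]\<close> are almost annihilated by the sections. The pointwise limits of
  \<open>v\<^sub>n\<close> seen from the two ends of the window lie in the kernels of \<open>QgQ\<close> and \<open>PgP\<close>. The first
  kernel is trivial by uniqueness for the Riemann--Hilbert problem, the second because the problem has
  a solution. Since the Hankel operators \<open>PgQ\<close> and \<open>QgP\<close> are compact, \<open>g v\<^sub>n\<close> is then close to its
  section and tends to \<open>0\<close> in norm, contradicting \<open>\<parallel>g v\<parallel> \<ge> \<delta> \<parallel>v\<parallel>\<close>.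

  Stability in \<open>\<ell>\<^sup>2\<close> already gives the rate in \<open>H\<^sup>s\<close>: the difference of \<open>u\<^sub>N\<close> and \<open>\<P>\<^sub>N u\<close> is \<open>O(N\<^sup>-\<^sup>t)\<close> in
  \<open>\<ell>\<^sup>2\<close> and lies in the range of \<open>\<P>\<^sub>N\<close>, where the \<open>H\<^sup>s\<close> norm costs at most a factor \<open>N\<^sup>s\<close>.
\<close>

section \<open>Coordinate projections and summable families\<close>

definition proj :: "'a set \<Rightarrow> ('a \<Rightarrow> 'b::zero) \<Rightarrow> 'a \<Rightarrow> 'b" where
  "proj S u = (\<lambda>j. if j \<in> S then u j else 0)"

lemma proj_apply: "proj S u j = (if j \<in> S then u j else 0)"
  by (simp add: proj_def)

lemma proj_proj: "proj S (proj T u) = proj (S \<inter> T) u"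
  by (auto simp: proj_def fun_eq_iff)

lemma proj_add: "proj S (u + v) = proj S u + proj S v" for u :: "'a \<Rightarrow> 'b::monoid_add"
  by (auto simp: proj_def fun_eq_iff)

lemma proj_diff: "proj S (u - v) = proj S u - proj S v" for u :: "'a \<Rightarrow> 'b::group_add"
  by (auto simp: proj_def fun_eq_iff)

lemma proj_add_proj_compl: "proj S u + proj (- S) u = u" for u :: "'a \<Rightarrow> 'b::monoid_add"
  by (auto simp: proj_def fun_eq_iff)

lemma proj_eq_self_iff: "proj S u = u \<longleftrightarrow> (\<forall>j. j \<notin> S \<longrightarrow> u j = 0)"
  by (auto simp: proj_def fun_eq_iff)

lemma proj_shift: "proj S (\<lambda>j. u (j - m)) = (\<lambda>j. proj {i. i + m \<in> S} u (j - m))"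
  for m :: "'a::group_add"
  by (simp add: proj_def fun_eq_iff)

lemma summable_on_small_tail:
  fixes f :: "'a \<Rightarrow> real"
  assumes "f summable_on UNIV" "e > 0"
  obtains A where "finite A" "\<And>F. finite F \<Longrightarrow> F \<inter> A = {} \<Longrightarrow> sum f F \<le> e"
proof -
  have "\<forall>\<^sub>F A in finite_subsets_at_top UNIV. dist (sum f A) (infsum f UNIV) < e / 2"
    using assms by (intro tendstoD[OF infsum_tendsto]) auto
  then obtain A where "finite A"
    and near: "\<And>T. finite T \<Longrightarrow> A \<subseteq> T \<Longrightarrow> dist (sum f T) (infsum f UNIV) < e / 2"
    by (auto simp: eventually_finite_subsets_at_top)
  have "sum f F \<le> e" if "finite F" "F \<inter> A = {}" for F
  proof -
    have "dist (sum f (F \<union> A)) (infsum f UNIV) < e / 2" "dist (sum f A) (infsum f UNIV) < e / 2"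
      using near[of "F \<union> A"] near[of A] that \<open>finite A\<close> by auto
    moreover have "sum f (F \<union> A) = sum f F + sum f A"
      using that \<open>finite A\<close> by (intro sum.union_disjoint) auto
    ultimately show ?thesis unfolding dist_real_def by linarith
  qed
  then show thesis by (rule that[OF \<open>finite A\<close>])
qed

text \<open>\<open>l2_le u B\<close> means that \<open>u\<close> lies in \<open>\<ell>\<^sup>2\<close> with norm at most \<open>B\<close>. Bounding the finite partial
  sums avoids the junk value of \<open>infsum\<close> on families that are not summable.\<close>

definition l2_le :: "('a \<Rightarrow> 'b::real_normed_vector) \<Rightarrow> real \<Rightarrow> bool" where
  "l2_le u B \<longleftrightarrow> (\<forall>F. finite F \<longrightarrow> L2_set (\<lambda>j. norm (u j)) F \<le> B)"

lemma l2_leI: "(\<And>F. finite F \<Longrightarrow> L2_set (\<lambda>j. norm (u j)) F \<le> B) \<Longrightarrow> l2_le u B"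
  by (simp add: l2_le_def)

lemma l2_leD: "l2_le u B \<Longrightarrow> finite F \<Longrightarrow> L2_set (\<lambda>j. norm (u j)) F \<le> B"
  by (simp add: l2_le_def)

lemma l2_le_nonneg: "l2_le u B \<Longrightarrow> 0 \<le> B"
  using l2_leD[of u B "{}"] by simp

lemma l2_le_norm: "l2_le u B \<Longrightarrow> norm (u j) \<le> B"
  using l2_leD[of u B "{j}"] by simp

lemma l2_le_bounded: "l2_le u B \<Longrightarrow> bounded (range u)"
  unfolding bounded_iff by (auto intro: l2_le_norm)

lemma l2_le_iff:
  "l2_le u B \<longleftrightarrow> 0 \<le> B \<and> (\<lambda>j. (norm (u j))\<^sup>2) summable_on UNIV \<and> (\<Sum>\<^sub>\<infinity>j. (norm (u j))\<^sup>2) \<le> B\<^sup>2"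
proof -
  have partial: "L2_set (\<lambda>j. norm (u j)) F \<le> B \<longleftrightarrow> (\<Sum>j\<in>F. (norm (u j))\<^sup>2) \<le> B\<^sup>2" if "0 \<le> B" for F
    unfolding L2_set_def using that by (auto intro: real_le_lsqrt sum_nonneg dest: sqrt_le_D)
  show ?thesis
  proof (intro iffI conjI)
    assume u: "l2_le u B"
    show "0 \<le> B" by (rule l2_le_nonneg[OF u])
    then have sums: "(\<Sum>j\<in>F. (norm (u j))\<^sup>2) \<le> B\<^sup>2" if "finite F" for F
      using l2_leD[OF u that] by (simp add: partial)
    then show "(\<lambda>j. (norm (u j))\<^sup>2) summable_on UNIV"
      by (intro nonneg_bdd_above_summable_on) (auto simp: bdd_above_def)
    then show "(\<Sum>\<^sub>\<infinity>j. (norm (u j))\<^sup>2) \<le> B\<^sup>2"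
      by (rule infsum_le_finite_sums) (use sums in auto)
  next
    assume u: "0 \<le> B \<and> (\<lambda>j. (norm (u j))\<^sup>2) summable_on UNIV \<and> (\<Sum>\<^sub>\<infinity>j. (norm (u j))\<^sup>2) \<le> B\<^sup>2"
    show "l2_le u B"
    proof (rule l2_leI)
      fix F :: "'a set" assume "finite F"
      then have "(\<Sum>j\<in>F. (norm (u j))\<^sup>2) \<le> (\<Sum>\<^sub>\<infinity>j. (norm (u j))\<^sup>2)"
        using u by (intro finite_sum_le_infsum) auto
      then show "L2_set (\<lambda>j. norm (u j)) F \<le> B" using u by (simp add: partial)
    qed
  qed
qed

lemma l2_le_mono: "l2_le u B \<Longrightarrow> B \<le> C \<Longrightarrow> l2_le u C"
  unfolding l2_le_def by (meson order_trans)

lemma l2_le_dominated: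
  assumes "l2_le u B" "\<And>j. norm (v j) \<le> norm (u j)"
  shows "l2_le v B"
proof (rule l2_leI)
  fix F :: "'a set" assume "finite F"
  have "L2_set (\<lambda>j. norm (v j)) F \<le> L2_set (\<lambda>j. norm (u j)) F"
    by (rule L2_set_mono) (use assms in auto)
  also have "\<dots> \<le> B" by (rule l2_leD[OF assms(1) \<open>finite F\<close>])
  finally show "L2_set (\<lambda>j. norm (v j)) F \<le> B" .
qed

lemma l2_le_proj: "l2_le u B \<Longrightarrow> l2_le (proj S u) B"
  by (erule l2_le_dominated) (simp add: proj_def)

lemma l2_le_uminus: "l2_le u B \<Longrightarrow> l2_le (- u) B"
  by (erule l2_le_dominated) simp

lemma l2_le_add:
  assumes "l2_le u B" "l2_le v C"
  shows "l2_le (u + v) (B + C)"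
proof (rule l2_leI)
  fix F :: "'a set" assume F: "finite F"
  have "L2_set (\<lambda>j. norm ((u + v) j)) F \<le> L2_set (\<lambda>j. norm (u j) + norm (v j)) F"
    by (intro L2_set_mono) (auto simp: norm_triangle_ineq)
  also have "\<dots> \<le> L2_set (\<lambda>j. norm (u j)) F + L2_set (\<lambda>j. norm (v j)) F"
    by (rule L2_set_triangle_ineq)
  also have "\<dots> \<le> B + C" by (intro add_mono l2_leD[OF _ F] assms)
  finally show "L2_set (\<lambda>j. norm ((u + v) j)) F \<le> B + C" .
qed

lemma l2_le_diff: "l2_le u B \<Longrightarrow> l2_le v C \<Longrightarrow> l2_le (u - v) (B + C)"
  using l2_le_add[OF _ l2_le_uminus, of u B v C] by simp

lemma l2_le_0: "l2_le 0 0"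
  by (simp add: l2_le_def L2_set_0')

lemma l2_le_0_iff: "l2_le u 0 \<longleftrightarrow> u = 0"
  using l2_le_norm[of u 0] l2_le_0 by auto

lemma l2_le_mult_iff:
  fixes u :: "'a \<Rightarrow> 'b::real_normed_div_algebra"
  assumes "a \<noteq> 0"
  shows "l2_le (\<lambda>j. a * u j) (norm a * B) \<longleftrightarrow> l2_le u B"
proof -
  have "L2_set (\<lambda>j. norm (a * u j)) F = norm a * L2_set (\<lambda>j. norm (u j)) F" for F
    by (simp add: norm_mult L2_set_right_distrib)
  then show ?thesis using assms by (simp add: l2_le_def)
qed

lemma l2_le_mult:
  fixes u :: "'a \<Rightarrow> 'b::real_normed_div_algebra"
  assumes "l2_le u B"
  shows "l2_le (\<lambda>j. a * u j) (norm a * B)"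
  using assms l2_le_mult_iff[of a u B] l2_le_0 by (cases "a = 0") (auto simp: zero_fun_def)

lemma l2_le_sum:
  assumes "finite J" "\<And>i. i \<in> J \<Longrightarrow> l2_le (f i) (b i)"
  shows "l2_le (\<lambda>k. \<Sum>i\<in>J. f i k) (\<Sum>i\<in>J. b i)"
  using assms
proof (induction J rule: finite_induct)
  case empty
  then show ?case using l2_le_0 by (simp add: zero_fun_def)
next
  case (insert i J)
  have "l2_le (f i + (\<lambda>k. \<Sum>i\<in>J. f i k)) (b i + (\<Sum>i\<in>J. b i))"
    by (intro l2_le_add insert) auto
  then show ?case using insert by (simp add: plus_fun_def)
qed

lemma l2_le_inj_comp:
  assumes "l2_le u B" "inj \<pi>"
  shows "l2_le (\<lambda>j. u (\<pi> j)) B"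
proof (rule l2_leI)
  fix F :: "'c set" assume "finite F"
  have "L2_set (\<lambda>j. norm (u (\<pi> j))) F = L2_set (\<lambda>j. norm (u j)) (\<pi> ` F)"
    unfolding L2_set_def using assms(2) by (subst sum.reindex) (auto intro: inj_on_subset)
  then show "L2_set (\<lambda>j. norm (u (\<pi> j))) F \<le> B"
    using l2_leD[OF assms(1)] \<open>finite F\<close> by simp
qed

lemma l2_le_shift: "l2_le u B \<Longrightarrow> l2_le (\<lambda>j. u (j - m)) B"
  for u :: "'a::group_add \<Rightarrow> 'b::real_normed_vector"
  by (erule l2_le_inj_comp) (simp add: inj_def)

lemma l2_le_shift_iff: "l2_le (\<lambda>j. u (j - m)) B \<longleftrightarrow> l2_le u B"
  for u :: "'a::group_add \<Rightarrow> 'b::real_normed_vector"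
  using l2_le_shift[of u B m] l2_le_shift[of "\<lambda>j. u (j - m)" B "- m"] by auto

lemma l2_le_proj_finite:
  assumes "finite A"
  shows "l2_le (proj A u) (L2_set (\<lambda>j. norm (u j)) A)"
proof (rule l2_leI)
  fix F :: "'a set" assume "finite F"
  have "(\<Sum>j\<in>F. (norm (proj A u j))\<^sup>2) = (\<Sum>j\<in>F \<inter> A. (norm (u j))\<^sup>2)"
    using \<open>finite F\<close> by (intro sum.mono_neutral_cong_right) (auto simp: proj_def)
  also have "\<dots> \<le> (\<Sum>j\<in>A. (norm (u j))\<^sup>2)"
    using assms by (intro sum_mono2) auto
  finally show "L2_set (\<lambda>j. norm (proj A u j)) F \<le> L2_set (\<lambda>j. norm (u j)) A"
    unfolding L2_set_def by (rule real_sqrt_le_mono)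
qed

lemma l2_le_tendsto:
  fixes x :: "'a \<Rightarrow> 'b::real_normed_vector"
  assumes "eventually (\<lambda>n. l2_le (v n) B) \<F>" "\<And>j. ((\<lambda>n. v n j) \<longlongrightarrow> x j) \<F>" "\<F> \<noteq> bot"
  shows "l2_le x B"
proof (rule l2_leI)
  fix F :: "'a set" assume F: "finite F"
  show "L2_set (\<lambda>j. norm (x j)) F \<le> B"
  proof (rule tendsto_upperbound[OF _ _ assms(3)])
    show "((\<lambda>n. L2_set (\<lambda>j. norm (v n j)) F) \<longlongrightarrow> L2_set (\<lambda>j. norm (x j)) F) \<F>"
      unfolding L2_set_def by (intro tendsto_intros assms)
    show "\<forall>\<^sub>F n in \<F>. L2_set (\<lambda>j. norm (v n j)) F \<le> B"
      using assms(1) by eventually_elim (rule l2_leD[OF _ F])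
  qed
qed

lemma l2_le_small_tail:
  assumes "l2_le u B" "e > 0"
  obtains A where "finite A" "l2_le (proj (- A) u) e"
proof -
  have "(\<lambda>j. (norm (u j))\<^sup>2) summable_on UNIV" using assms(1) by (simp add: l2_le_iff)
  then obtain A where A: "finite A"
    and tail: "\<And>F. finite F \<Longrightarrow> F \<inter> A = {} \<Longrightarrow> (\<Sum>j\<in>F. (norm (u j))\<^sup>2) \<le> e\<^sup>2"
    by (rule summable_on_small_tail[of _ "e\<^sup>2"]) (use assms(2) in auto)
  have "l2_le (proj (- A) u) e"
  proof (rule l2_leI)
    fix F :: "'a set" assume F: "finite F"
    have "(\<Sum>j\<in>F. (norm (proj (- A) u j))\<^sup>2) = (\<Sum>j\<in>F - A. (norm (u j))\<^sup>2)"
      using F by (intro sum.mono_neutral_cong_right) (auto simp: proj_def)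
    also have "\<dots> \<le> e\<^sup>2" by (rule tail) (use F in auto)
    finally show "L2_set (\<lambda>j. norm (proj (- A) u j)) F \<le> e"
      unfolding L2_set_def using assms(2) by (simp add: real_le_lsqrt sum_nonneg)
  qed
  with A show thesis by (rule that)
qed

definition l2_stable :: "real \<Rightarrow> ('a \<Rightarrow> 'b::real_normed_vector) set \<Rightarrow>
    (('a \<Rightarrow> 'b) \<Rightarrow> 'c \<Rightarrow> 'd::real_normed_vector) \<Rightarrow> bool" where
  "l2_stable \<kappa> V f \<longleftrightarrow> (\<forall>v\<in>V. \<forall>B. l2_le (f v) B \<longrightarrow> l2_le v (\<kappa> * B))"

lemma l2_stableD: "l2_stable \<kappa> V f \<Longrightarrow> v \<in> V \<Longrightarrow> l2_le (f v) B \<Longrightarrow> l2_le v (\<kappa> * B)"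
  by (simp add: l2_stable_def)

lemma l2_stable_kernel: "l2_stable \<kappa> V f \<Longrightarrow> v \<in> V \<Longrightarrow> f v = 0 \<Longrightarrow> v = 0"
  using l2_stableD[of \<kappa> V f v 0] by (simp add: l2_le_0_iff)

abbreviation in_l1 :: "('a \<Rightarrow> 'b::real_normed_vector) \<Rightarrow> bool" where
  "in_l1 u \<equiv> (\<lambda>j. norm (u j)) summable_on UNIV"

definition l1_norm :: "('a \<Rightarrow> 'b::real_normed_vector) \<Rightarrow> real" where
  "l1_norm u = (\<Sum>\<^sub>\<infinity>j. norm (u j))"

lemma l1_norm_nonneg: "0 \<le> l1_norm u"
  by (simp add: l1_norm_def infsum_nonneg)

lemma sum_norm_le_l1_norm: "in_l1 u \<Longrightarrow> finite F \<Longrightarrow> (\<Sum>j\<in>F. norm (u j)) \<le> l1_norm u"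
  unfolding l1_norm_def by (intro finite_sum_le_infsum) auto

lemma in_l1_bounded: "in_l1 u \<Longrightarrow> bounded (range u)"
  unfolding bounded_iff using sum_norm_le_l1_norm[of u "{_}"] by auto

lemma in_l1_dominated: "in_l1 u \<Longrightarrow> (\<And>j. norm (v j) \<le> norm (u j)) \<Longrightarrow> in_l1 v"
  by (erule Infinite_Sum.abs_summable_on_comparison_test)

lemma in_l1_proj: "in_l1 u \<Longrightarrow> in_l1 (proj S u)"
  by (erule in_l1_dominated) (simp add: proj_def)

lemma in_l1_add: "in_l1 u \<Longrightarrow> in_l1 v \<Longrightarrow> in_l1 (u + v)"
  by (rule Infinite_Sum.abs_summable_on_comparison_test'
        [where g = "\<lambda>j. norm (u j) + norm (v j)"])
     (auto intro: summable_on_add simp: norm_triangle_ineq)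

lemma in_l1_finite_support: "finite A \<Longrightarrow> (\<And>j. j \<notin> A \<Longrightarrow> u j = 0) \<Longrightarrow> in_l1 u"
  by (rule finite_nonzero_values_imp_summable_on, erule finite_subset[rotated]) auto

lemma l1_small_tail:
  assumes "in_l1 u" "e > 0"
  obtains A where "finite A" "l1_norm (proj (- A) u) \<le> e"
proof -
  obtain A where A: "finite A"
    and tail: "\<And>F. finite F \<Longrightarrow> F \<inter> A = {} \<Longrightarrow> (\<Sum>j\<in>F. norm (u j)) \<le> e"
    using summable_on_small_tail[OF assms] by blast
  have "l1_norm (proj (- A) u) \<le> e"
    unfolding l1_norm_def
  proof (rule infsum_le_finite_sums[OF in_l1_proj[OF assms(1)]])
    fix F :: "'a set" assume F: "finite F"
    have "(\<Sum>j\<in>F. norm (proj (- A) u j)) = (\<Sum>j\<in>F - A. norm (u j))"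
      using F by (intro sum.mono_neutral_cong_right) (auto simp: proj_def)
    also have "\<dots> \<le> e" by (rule tail) (use F in auto)
    finally show "(\<Sum>j\<in>F. norm (proj (- A) u j)) \<le> e" .
  qed
  with A show thesis by (rule that)
qed

section \<open>Convolution\<close>

lemma Mult_abs_summable:
  assumes "in_l1 g" "bounded (range u)"
  shows "(\<lambda>j. cmod (g j * u (k - j))) summable_on UNIV"
proof -
  obtain B where B: "\<And>j. cmod (u j) \<le> B" using assms(2) by (auto simp: bounded_iff)
  show ?thesis
  proof (rule Infinite_Sum.abs_summable_on_comparison_test')
    show "(\<lambda>j. cmod (g j) * B) summable_on UNIV" by (rule summable_on_cmult_left[OF assms(1)])
    show "cmod (g j * u (k - j)) \<le> cmod (g j) * B" for j
      unfolding norm_mult by (intro mult_left_mono B) auto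
  qed
qed

lemma Mult_summable:
  "in_l1 g \<Longrightarrow> bounded (range u) \<Longrightarrow> (\<lambda>j. g j * u (k - j)) summable_on UNIV" for g u :: lcoef
  by (rule abs_summable_summable) (rule Mult_abs_summable)

lemma Mult_commute: "Mult g u = Mult u g"
proof
  show "Mult g u k = Mult u g k" for k
    unfolding Mult_def
    by (rule infsum_reindex_bij_witness[where i="\<lambda>j. k - j" and j="\<lambda>j. k - j"]) auto
qed

lemma Mult_add_right:
  assumes "in_l1 g" "bounded (range u)" "bounded (range v)"
  shows "Mult g (u + v) = Mult g u + Mult g v"
proof
  show "Mult g (u + v) k = (Mult g u + Mult g v) k" for k
    using infsum_add[OF Mult_summable[OF assms(1,2), of k] Mult_summable[OF assms(1,3), of k]]
    by (simp add: Mult_def distrib_left)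
qed

lemma Mult_add_left:
  assumes "in_l1 g" "in_l1 h" "bounded (range u)"
  shows "Mult (g + h) u = Mult g u + Mult h u"
proof
  show "Mult (g + h) u k = (Mult g u + Mult h u) k" for k
    using infsum_add[OF Mult_summable[OF assms(1,3), of k] Mult_summable[OF assms(2,3), of k]]
    by (simp add: Mult_def distrib_right)
qed

lemma Mult_uminus_right: "Mult g (- u) = - Mult g u"
  by (simp add: Mult_def fun_eq_iff infsum_uminus)

lemma Mult_diff_right:
  assumes "in_l1 g" "bounded (range u)" "bounded (range v)"
  shows "Mult g (u - v) = Mult g u - Mult g v"
proof -
  have "bounded (range (- v))" using assms(3) by (simp add: bounded_iff)
  from Mult_add_right[OF assms(1,2) this] show ?thesis
    by (simp only: Mult_uminus_right diff_conv_add_uminus)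
qed

lemma Mult_scale_right: "Mult g (\<lambda>j. a * u j) = (\<lambda>k. a * Mult g u k)"
  by (simp add: Mult_def fun_eq_iff mult.left_commute[of _ a] infsum_cmult_right')

lemma Mult_shift_right: "Mult g (\<lambda>j. u (j - m)) k = Mult g u (k - m)"
  by (simp add: Mult_def algebra_simps)

lemma Mult_proj_left: "finite A \<Longrightarrow> Mult (proj A g) u k = (\<Sum>j\<in>A. g j * u (k - j))"
  unfolding Mult_def
  by (subst infsum_cong_neutral[where T=A and g="\<lambda>j. g j * u (k - j)"]) (auto simp: proj_def)

lemma Mult_proj_right: "finite A \<Longrightarrow> Mult g (proj A u) k = (\<Sum>j\<in>A. g (k - j) * u j)"
  by (simp add: Mult_commute[of g] Mult_proj_left mult.commute)

lemma Mult_one_right: "Mult g one_c = g"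
proof
  have one_c: "one_c = proj {0} (\<lambda>_. 1)" by (auto simp: one_c_def proj_def)
  show "Mult g one_c k = g k" for k unfolding one_c by (subst Mult_proj_right) auto
qed

lemma Mult_eq_0: "(\<And>j. g j = 0 \<or> u (k - j) = 0) \<Longrightarrow> Mult g u k = 0"
  unfolding Mult_def by (rule infsum_0) simp

lemma triangular_Mult_injective:
  assumes diag: "m 0 \<noteq> 0" "\<And>j. j > 0 \<Longrightarrow> m j = 0"
    and h: "\<And>j. j \<ge> a \<Longrightarrow> h j = 0" "Mult m h = 0"
  shows "h = 0"
proof -
  have vanish: "h k = 0" if "k \<ge> a - int n" for n k
    using that
  proof (induction n arbitrary: k)
    case 0
    then show ?case by (simp add: h(1))
  next
    case (Suc n)
    have "Mult m h k = Mult (proj {0} m) h k"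
      unfolding Mult_def
    proof (rule infsum_cong)
      fix j
      show "m j * h (k - j) = proj {0} m j * h (k - j)"
        using diag(2)[of j] Suc.IH[of "k - j"] Suc.prems
        by (cases j "0::int" rule: linorder_cases) (auto simp: proj_def)
    qed
    then have "m 0 * h k = 0" using h(2) by (simp add: Mult_proj_left)
    then show ?case using diag(1) by simp
  qed
  have "h k = 0" for k by (rule vanish[of "nat (a - k)"]) simp
  then show ?thesis by (simp add: fun_eq_iff)
qed

lemma convolution_summable:
  fixes a b :: lcoef
  assumes "in_l1 a" "in_l1 b"
  shows "(\<lambda>(k, j). cmod (a j * b (k - j))) summable_on UNIV \<times> UNIV"
proof -
  have prod: "(\<lambda>x. cmod (case x of (j, i) \<Rightarrow> a j * b i)) summable_on UNIV \<times> UNIV"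
    by (subst Infinite_Sum.abs_summable_on_Sigma_iff)
       (auto simp: norm_mult infsum_cmult_right' abs_mult infsum_nonneg
             intro!: summable_on_cmult_right summable_on_cmult_left assms)
  have "bij_betw (\<lambda>(k, j). (j, k - j)) (UNIV \<times> UNIV) (UNIV \<times> (UNIV :: int set))"
    by (rule bij_betwI[where g="\<lambda>(j, i). (i + j, j)"]) auto
  from summable_on_reindex_bij_betw[OF this, of "\<lambda>x. cmod (case x of (j, i) \<Rightarrow> a j * b i)"] prod
  show ?thesis by (simp add: case_prod_unfold)
qed

lemma in_l1_Mult:
  assumes "in_l1 a" "in_l1 b"
  shows "in_l1 (Mult a b)"
proof (rule Infinite_Sum.abs_summable_on_comparison_test')
  show "(\<lambda>k. \<Sum>\<^sub>\<infinity>j. cmod (a j * b (k - j))) summable_on UNIV"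
    using summable_on_Sigma_banach[OF convolution_summable[OF assms]] by simp
  show "cmod (Mult a b k) \<le> (\<Sum>\<^sub>\<infinity>j. cmod (a j * b (k - j)))" for k
    unfolding Mult_def by (intro norm_infsum_bound Mult_abs_summable assms in_l1_bounded)
qed

lemma Mult_assoc:
  assumes "in_l1 a" "in_l1 b" "bounded (range u)"
  shows "Mult a (Mult b u) = Mult (Mult a b) u"
proof
  fix k
  define f where "f l i = a i * b (l - i) * u (k - l)" for l i
  obtain B where B: "\<And>j. cmod (u j) \<le> B" using assms(3) by (auto simp: bounded_iff)
  have "(\<lambda>x. cmod (case x of (l, i) \<Rightarrow> f l i)) summable_on UNIV \<times> UNIV"
  proof (rule Infinite_Sum.abs_summable_on_comparison_test')
    show "(\<lambda>x. (case x of (l, i) \<Rightarrow> cmod (a i * b (l - i))) * B) summable_on UNIV \<times> UNIV"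
      by (intro summable_on_cmult_left convolution_summable assms)
  qed (auto simp: f_def norm_mult intro!: mult_left_mono B)
  then have f: "(\<lambda>(l, i). f l i) summable_on UNIV \<times> UNIV"
    by (rule abs_summable_summable)
  have "(\<Sum>\<^sub>\<infinity>j. a i * (b j * u (k - i - j))) = (\<Sum>\<^sub>\<infinity>l. f l i)" for i
    by (rule infsum_reindex_bij_witness[where i="\<lambda>l. l - i" and j="\<lambda>j. j + i"])
       (auto simp: f_def algebra_simps)
  then have "Mult a (Mult b u) k = (\<Sum>\<^sub>\<infinity>i. \<Sum>\<^sub>\<infinity>l. f l i)"
    by (simp add: Mult_def infsum_cmult_right')
  also have "\<dots> = (\<Sum>\<^sub>\<infinity>l. \<Sum>\<^sub>\<infinity>i. f l i)"
    by (rule infsum_swap_banach[OF f, symmetric])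
  also have "\<dots> = Mult (Mult a b) u k"
    by (simp add: Mult_def f_def infsum_cmult_left')
  finally show "Mult a (Mult b u) k = Mult (Mult a b) u k" .
qed

lemma l2_le_Mult:
  assumes "in_l1 g" "l2_le u B"
  shows "l2_le (Mult g u) (l1_norm g * B)"
proof (rule l2_le_tendsto)
  show "((\<lambda>J. \<Sum>j\<in>J. g j * u (k - j)) \<longlongrightarrow> Mult g u k) (finite_subsets_at_top UNIV)" for k
    unfolding Mult_def by (intro infsum_tendsto Mult_summable assms(1) l2_le_bounded[OF assms(2)])
  have "l2_le (\<lambda>k. \<Sum>j\<in>J. g j * u (k - j)) (l1_norm g * B)" if "finite J" for J
  proof (rule l2_le_mono)
    show "l2_le (\<lambda>k. \<Sum>j\<in>J. g j * u (k - j)) (\<Sum>j\<in>J. cmod (g j) * B)"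
      by (intro l2_le_sum l2_le_mult l2_le_shift that assms(2))
    show "(\<Sum>j\<in>J. cmod (g j) * B) \<le> l1_norm g * B"
      unfolding sum_distrib_right[symmetric]
      by (intro mult_right_mono sum_norm_le_l1_norm that assms(1) l2_le_nonneg[OF assms(2)])
  qed
  then show "\<forall>\<^sub>F J in finite_subsets_at_top UNIV. l2_le (\<lambda>k. \<Sum>j\<in>J. g j * u (k - j)) (l1_norm g * B)"
    by (simp add: eventually_finite_subsets_at_top_weakI)
qed simp

section \<open>Multiplication is bounded below\<close>

lemma sum_powi_roots_unity:
  assumes "n > 0" "\<not> int n dvd d"
  shows "(\<Sum>z | z ^ n = 1. z powi d) = (0 :: complex)"
proof -
  define w where "w = cis (2 * pi / real n)"
  have w: "w \<noteq> 0" "w ^ n = 1"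
    using assms(1) by (auto simp: w_def Complex.DeMoivre)
  have "w powi d \<noteq> 1"
  proof
    assume "w powi d = 1"
    then have "cos (2 * pi * real_of_int d / real n) = 1"
      by (simp add: w_def cis_power_int complex_eq_iff mult.commute)
    then obtain k :: int where "2 * pi * real_of_int d / real n = real_of_int k * 2 * pi"
      unfolding cos_one_2pi_int by auto
    then have "real_of_int d = real_of_int (k * int n)" using assms(1) by (simp add: field_simps)
    then have "d = k * int n" by linarith
    then show False using assms(2) by simp
  qed
  have "bij_betw ((*) w) {z. z ^ n = 1} {z. z ^ n = 1}"
    using w by (intro bij_betwI[where g="\<lambda>z. z / w"]) (auto simp: power_mult_distrib power_divide)
  then have "(\<Sum>z | z ^ n = 1. z powi d) = (\<Sum>z | z ^ n = 1. (w * z) powi d)"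
    by (rule sum.reindex_bij_betw[symmetric])
  also have "\<dots> = w powi d * (\<Sum>z | z ^ n = 1. z powi d)"
    by (simp add: power_int_mult_distrib sum_distrib_left)
  finally show ?thesis using \<open>w powi d \<noteq> 1\<close> by simp
qed

lemma discrete_parseval:
  fixes a :: lcoef
  assumes "n > 0" "finite S" "\<And>i j. i \<in> S \<Longrightarrow> j \<in> S \<Longrightarrow> \<bar>i - j\<bar> < int n"
  shows "L2_set (\<lambda>z. cmod (\<Sum>j\<in>S. a j * z powi j)) {z. z ^ n = 1} = sqrt n * L2_set (\<lambda>j. cmod (a j)) S"
proof -
  let ?R = "{z :: complex. z ^ n = 1}"
  have powi_cnj: "z powi i * cnj (z powi j) = z powi (i - j)" if "z \<in> ?R" for z i j
  proof -
    have "cmod z = 1" using that assms(1) power_eq_1_iff[of z n] by auto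
    then have cnj: "cnj z = inverse z" and "z \<noteq> 0"
      by (auto simp: inverse_complex_def complex_eq_iff cmod_def)
    then show ?thesis
      unfolding complex_cnj_power_int cnj by (simp add: power_int_inverse power_int_diff divide_inverse)
  qed
  have orthogonal: "(\<Sum>z\<in>?R. z powi (i - j)) = (if j = i then of_nat n else 0)" if "i \<in> S" "j \<in> S" for i j
    using sum_powi_roots_unity[OF assms(1), of "i - j"] assms(1) assms(3)[OF that]
      zdvd_imp_le[of "int n" "\<bar>i - j\<bar>"]
    by (auto simp: card_roots_unity_eq)
  have "complex_of_real (\<Sum>z\<in>?R. (cmod (\<Sum>j\<in>S. a j * z powi j))\<^sup>2)
      = (\<Sum>z\<in>?R. \<Sum>i\<in>S. \<Sum>j\<in>S. a i * cnj (a j) * (z powi i * cnj (z powi j)))"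
    unfolding of_real_sum complex_norm_square cnj_sum sum_product by (simp add: algebra_simps)
  also have "\<dots> = (\<Sum>z\<in>?R. \<Sum>i\<in>S. \<Sum>j\<in>S. a i * cnj (a j) * z powi (i - j))"
    by (simp only: powi_cnj cong: sum.cong)
  also have "\<dots> = (\<Sum>i\<in>S. \<Sum>j\<in>S. a i * cnj (a j) * (\<Sum>z\<in>?R. z powi (i - j)))"
    by (subst sum.swap, intro sum.cong refl, subst sum.swap) (simp add: sum_distrib_left)
  also have "\<dots> = (\<Sum>i\<in>S. \<Sum>j\<in>S. if j = i then a i * cnj (a i) * of_nat n else 0)"
    by (intro sum.cong refl) (auto simp: orthogonal)
  also have "\<dots> = complex_of_real (real n * (\<Sum>j\<in>S. (cmod (a j))\<^sup>2))"
    using assms(2) by (simp add: complex_norm_square sum_distrib_left mult.commute del: of_real_power)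
  finally have "(\<Sum>z\<in>?R. (cmod (\<Sum>j\<in>S. a j * z powi j))\<^sup>2) = real n * (\<Sum>j\<in>S. (cmod (a j))\<^sup>2)"
    unfolding of_real_eq_iff .
  then show ?thesis by (simp add: L2_set_def real_sqrt_mult)
qed

lemma bounded_powi: "cmod z = 1 \<Longrightarrow> bounded (range (\<lambda>j. z powi - j))"
  by (auto simp: bounded_iff norm_power_int)

lemma Mult_powi:
  assumes "z \<noteq> 0"
  shows "Mult g (\<lambda>j. z powi - j) = (\<lambda>k. lval g z * z powi - k)"
proof
  fix k
  have "z powi - (k - j) = z powi j * z powi - k" for j
    using assms power_int_add[of z j "- k"] by simp
  then show "Mult g (\<lambda>j. z powi - j) k = lval g z * z powi - k"
    by (simp add: Mult_def lval_def infsum_cmult_left' flip: mult.assoc)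
qed

lemma lval_eq_Mult: "lval g z = Mult g (\<lambda>j. z powi - j) 0"
  by (simp add: lval_def Mult_def)

lemma lval_Mult:
  assumes "in_l1 g" "in_l1 h" "cmod z = 1"
  shows "lval (Mult g h) z = lval g z * lval h z"
proof -
  have "z \<noteq> 0" using assms(3) by auto
  have "lval (Mult g h) z = Mult g (Mult h (\<lambda>j. z powi - j)) 0"
    by (simp add: lval_eq_Mult Mult_assoc assms bounded_powi)
  also have "\<dots> = lval g z * lval h z"
    by (simp add: Mult_powi[OF \<open>z \<noteq> 0\<close>] Mult_scale_right)
  finally show ?thesis .
qed

lemma lval_add: "in_l1 g \<Longrightarrow> in_l1 h \<Longrightarrow> cmod z = 1 \<Longrightarrow> lval (g + h) z = lval g z + lval h z"
  by (simp add: lval_eq_Mult Mult_add_left bounded_powi)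

lemma lval_proj: "finite A \<Longrightarrow> lval (proj A g) z = (\<Sum>j\<in>A. g j * z powi j)"
  by (simp add: lval_eq_Mult Mult_proj_left)

lemma cmod_lval_le:
  assumes "in_l1 g" "cmod z = 1"
  shows "cmod (lval g z) \<le> l1_norm g"
proof -
  have "cmod (g j * z powi j) = cmod (g j)" for j
    using assms(2) by (simp add: norm_mult norm_power_int)
  then show ?thesis
    unfolding lval_def l1_norm_def
    using norm_infsum_bound[of "\<lambda>j. g j * z powi j" UNIV] assms(1) by simp
qed

lemma eventually_discrete_parseval:
  assumes "finite A"
  shows "\<forall>\<^sub>F n in sequentially.
    L2_set (\<lambda>z. cmod (lval (proj A f) z)) {z. z ^ n = 1} = sqrt n * L2_set (\<lambda>j. cmod (f j)) A"
proof -
  have "\<forall>\<^sub>F n in sequentially. \<forall>i\<in>A. \<forall>j\<in>A. \<bar>i - j\<bar> < int n"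
  proof (intro eventually_ball_finite ballI assms)
    show "\<forall>\<^sub>F n in sequentially. \<bar>i - j\<bar> < int n" for i j :: int
      using eventually_gt_at_top[of "nat \<bar>i - j\<bar>"] by eventually_elim auto
  qed
  then show ?thesis
    using eventually_gt_at_top[of 0]
    by eventually_elim (simp add: lval_proj assms discrete_parseval)
qed

text \<open>Away from a finite set of modes \<open>f\<close> is small in \<open>\<ell>\<^sup>1\<close>, hence uniformly small on the circle; on the
  finite set the discrete Parseval identity is exact as soon as there are more nodes than modes.\<close>

lemma sampled_L2_le:
  assumes f: "in_l1 f" "l2_le f B" and "e > 0"
  shows "\<forall>\<^sub>F n in sequentially. L2_set (\<lambda>z. cmod (lval f z)) {z. z ^ n = 1} \<le> sqrt n * (B + e)"
proof -
  obtain A where A: "finite A" "l1_norm (proj (- A) f) \<le> e"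
    using l1_small_tail[OF f(1) \<open>e > 0\<close>] by blast
  show ?thesis
    using eventually_discrete_parseval[OF A(1), of f] eventually_gt_at_top[of 0]
  proof eventually_elim
    case (elim n)
    let ?R = "{z :: complex. z ^ n = 1}"
    have "cmod (lval f z) \<le> cmod (lval (proj A f) z) + e" if "z \<in> ?R" for z
    proof -
      have z: "cmod z = 1" using that \<open>0 < n\<close> power_eq_1_iff[of z n] by auto
      have "lval f z = lval (proj A f) z + lval (proj (- A) f) z"
        using lval_add[OF in_l1_proj[OF f(1), of A] in_l1_proj[OF f(1), of "- A"] z]
        by (simp add: proj_add_proj_compl)
      also have "cmod \<dots> \<le> cmod (lval (proj A f) z) + e"
        using cmod_lval_le[OF in_l1_proj[OF f(1), of "- A"] z] A(2) by (intro norm_triangle_le) auto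
      finally show ?thesis .
    qed
    then have "L2_set (\<lambda>z. cmod (lval f z)) ?R \<le> L2_set (\<lambda>z. cmod (lval (proj A f) z) + e) ?R"
      by (intro L2_set_mono) auto
    also have "\<dots> \<le> L2_set (\<lambda>z. cmod (lval (proj A f) z)) ?R + L2_set (\<lambda>_. e) ?R"
      by (rule L2_set_triangle_ineq)
    also have "\<dots> = sqrt n * L2_set (\<lambda>j. cmod (f j)) A + sqrt n * e"
      using elim \<open>e > 0\<close> by (simp add: L2_set_constant card_roots_unity_eq)
    also have "\<dots> \<le> sqrt n * (B + e)"
      using l2_leD[OF f(2) A(1)] by (simp add: distrib_left mult_left_mono)
    finally show ?case .
  qed
qed

locale nonvanishing_symbol =
  fixes g :: lcoef and \<delta> :: real
  assumes g_l1: "in_l1 g"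
    and \<delta>_pos: "\<delta> > 0"
    and \<delta>_le: "cmod z = 1 \<Longrightarrow> \<delta> \<le> cmod (lval g z)"
begin

lemma L2_set_le_Mult:
  assumes A: "finite A" "proj A x = x" and B: "l2_le (Mult g x) B"
  shows "\<delta> * L2_set (\<lambda>j. cmod (x j)) A \<le> B"
proof (rule field_le_epsilon)
  fix e :: real assume "e > 0"
  have x: "in_l1 x" using A by (auto intro: in_l1_finite_support simp: proj_eq_self_iff)
  have "\<forall>\<^sub>F n in sequentially. \<delta> * L2_set (\<lambda>j. cmod (x j)) A \<le> B + e"
    using eventually_discrete_parseval[OF A(1), of x] eventually_gt_at_top[of 0]
      sampled_L2_le[OF in_l1_Mult[OF g_l1 x] B \<open>e > 0\<close>]
  proof eventually_elim
    case (elim n)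
    let ?R = "{z :: complex. z ^ n = 1}"
    have "sqrt n * (\<delta> * L2_set (\<lambda>j. cmod (x j)) A) = L2_set (\<lambda>z. \<delta> * cmod (lval x z)) ?R"
      using elim(1) \<delta>_pos by (simp add: A(2) flip: L2_set_right_distrib)
    also have "\<dots> \<le> L2_set (\<lambda>z. cmod (lval (Mult g x) z)) ?R"
    proof (rule L2_set_mono)
      fix z assume "z \<in> ?R"
      then have z: "cmod z = 1" using \<open>0 < n\<close> power_eq_1_iff[of z n] by auto
      then show "\<delta> * cmod (lval x z) \<le> cmod (lval (Mult g x) z)"
        by (simp add: lval_Mult g_l1 x norm_mult mult_right_mono \<delta>_le)
    qed (use \<delta>_pos in auto)
    also have "\<dots> \<le> sqrt n * (B + e)" by (rule elim(3))
    finally show ?case using \<open>0 < n\<close> by simp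
  qed
  then show "\<delta> * L2_set (\<lambda>j. cmod (x j)) A \<le> B + e" by simp
qed

theorem Mult_bounded_below:
  assumes x: "l2_le x C" and B: "l2_le (Mult g x) B"
  shows "l2_le x (B / \<delta>)"
proof (rule l2_leI)
  fix F :: "int set" assume F: "finite F"
  have "\<delta> * L2_set (\<lambda>j. cmod (x j)) F \<le> B"
  proof (rule field_le_epsilon)
    fix e :: real assume "e > 0"
    define d where "d = e / (l1_norm g + 1)"
    have d: "d > 0" "l1_norm g * d \<le> e"
      using \<open>e > 0\<close> l1_norm_nonneg[of g] by (auto simp: d_def field_simps)
    obtain A where A: "finite A" "l2_le (proj (- A) x) d"
      using l2_le_small_tail[OF x d(1)] by blast
    define A' where "A' = A \<union> F"
    have A': "finite A'" "F \<subseteq> A'" using A F by (auto simp: A'_def)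
    have tail: "l2_le (proj (- A') x) d"
      using l2_le_proj[OF A(2), of "- A'"] by (simp add: proj_proj A'_def Int_absorb2)
    have "Mult g (proj A' x) = Mult g x - Mult g (proj (- A') x)"
      using Mult_add_right[OF g_l1 l2_le_bounded[OF l2_le_proj[OF x]] l2_le_bounded[OF tail], of A']
      by (simp add: proj_add_proj_compl)
    then have "l2_le (Mult g (proj A' x)) (B + l1_norm g * d)"
      using l2_le_diff[OF B l2_le_Mult[OF g_l1 tail]] by simp
    then have "\<delta> * L2_set (\<lambda>j. cmod (proj A' x j)) A' \<le> B + e"
      using L2_set_le_Mult[OF A'(1), of "proj A' x"] d(2) by (force simp: proj_proj)
    moreover have "L2_set (\<lambda>j. cmod (x j)) F \<le> L2_set (\<lambda>j. cmod (proj A' x j)) A'"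
      using A' F unfolding L2_set_def
      by (intro real_sqrt_le_mono sum_le_included[where i=id]) (auto simp: proj_def)
    ultimately show "\<delta> * L2_set (\<lambda>j. cmod (x j)) F \<le> B + e"
      using \<delta>_pos mult_left_mono by (smt (verit))
  qed
  then show "L2_set (\<lambda>j. cmod (x j)) F \<le> B / \<delta>"
    using \<delta>_pos by (simp add: field_simps)
qed

corollary Mult_eq_0_imp_eq_0: "l2_le x C \<Longrightarrow> Mult g x = 0 \<Longrightarrow> x = 0"
  using Mult_bounded_below[of x C 0] by (simp add: l2_le_0_iff)

end

section \<open>Stability of finite sections\<close>

definition reaching_modes :: "int set \<Rightarrow> int set \<Rightarrow> int set \<Rightarrow> int set" where
  "reaching_modes A S E = {i \<in> S. \<exists>k\<in>E. k - i \<in> A}"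

lemma l2_le_proj_Mult:
  assumes g: "in_l1 g" and A: "finite A" and F: "finite (reaching_modes A S E)"
    and v: "l2_le v B" "proj S v = v"
  shows "l2_le (proj E (Mult g v))
    (l1_norm (proj A g) * L2_set (\<lambda>j. cmod (v j)) (reaching_modes A S E) + l1_norm (proj (- A) g) * B)"
proof -
  let ?F = "reaching_modes A S E"
  have "v (k - j) = proj ?F v (k - j)" if "k \<in> E" "j \<in> A" for k j
    using that fun_cong[OF v(2), of "k - j"] by (auto simp: proj_def reaching_modes_def split: if_splits)
  then have "proj E (Mult (proj A g) v) = proj E (Mult (proj A g) (proj ?F v))"
    by (auto simp: fun_eq_iff proj_apply[of E] Mult_proj_left[OF A] intro!: sum.cong)
  moreover have "Mult g v = Mult (proj A g) v + Mult (proj (- A) g) v"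
    using Mult_add_left[OF in_l1_proj[OF g] in_l1_proj[OF g] l2_le_bounded[OF v(1)], of A "- A"]
    by (simp add: proj_add_proj_compl)
  ultimately have "proj E (Mult g v) =
      proj E (Mult (proj A g) (proj ?F v)) + proj E (Mult (proj (- A) g) v)"
    by (simp add: proj_add)
  then show ?thesis
    using l2_le_add[OF l2_le_proj[OF l2_le_Mult[OF in_l1_proj[OF g] l2_le_proj_finite[OF F]]]
        l2_le_proj[OF l2_le_Mult[OF in_l1_proj[OF g] v(1)]]]
    by simp
qed

text \<open>The operator from modes in \<open>S\<close> to modes in \<open>E\<close> is compact: only finitely many modes of \<open>S\<close>
  reach \<open>E\<close> through a finite part of the symbol, and the rest of the symbol is small in \<open>\<ell>\<^sup>1\<close>.\<close>

lemma proj_Mult_null: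
  assumes g: "in_l1 g" and S: "\<And>A. finite A \<Longrightarrow> finite (reaching_modes A S E)"
    and v: "\<And>n. l2_le (v n) B" "\<And>n. proj S (v n) = v n" "\<And>j. (\<lambda>n. v n j) \<longlonglongrightarrow> 0" and "e > 0"
  shows "\<forall>\<^sub>F n in sequentially. l2_le (proj E (Mult g (v n))) e"
proof -
  have "B \<ge> 0" using l2_le_nonneg[OF v(1)] .
  define d where "d = e / (2 * (B + 1))"
  have d: "d > 0" "d * B \<le> e / 2"
    using \<open>e > 0\<close> \<open>B \<ge> 0\<close> by (auto simp: d_def field_simps)
  obtain A where A: "finite A" "l1_norm (proj (- A) g) \<le> d"
    using l1_small_tail[OF g d(1)] by blast
  then have tail: "l1_norm (proj (- A) g) * B \<le> e / 2"
    using mult_right_mono[OF A(2) \<open>B \<ge> 0\<close>] d(2) by linarith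
  define F where "F = reaching_modes A S E"
  have "(\<lambda>n. l1_norm (proj A g) * L2_set (\<lambda>j. cmod (v n j)) F)
      \<longlonglongrightarrow> l1_norm (proj A g) * sqrt (\<Sum>j\<in>F. (cmod 0)\<^sup>2)"
    unfolding L2_set_def by (intro tendsto_intros v(3))
  then have "\<forall>\<^sub>F n in sequentially. l1_norm (proj A g) * L2_set (\<lambda>j. cmod (v n j)) F < e / 2"
    by (rule order_tendstoD(2)) (use \<open>e > 0\<close> in simp)
  then show ?thesis
  proof eventually_elim
    case (elim n)
    show ?case
      by (rule l2_le_mono[OF l2_le_proj_Mult[OF g A(1) S[OF A(1)] v(1,2)]])
         (use elim tail in \<open>simp add: F_def\<close>)
  qed
qed

lemma Mult_tendsto:
  assumes g: "in_l1 g" and v: "\<And>n. l2_le (v n) B" and x: "\<And>j. (\<lambda>n. v n j) \<longlonglongrightarrow> x j"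
  shows "(\<lambda>n. Mult g (v n) k) \<longlonglongrightarrow> Mult g x k"
proof -
  have xB: "l2_le x B" using x v by (intro l2_le_tendsto[of v B sequentially]) auto
  have "(\<lambda>n. Mult g (v n - x) k) \<longlonglongrightarrow> 0"
  proof (rule tendstoI)
    fix e :: real assume "e > 0"
    have "\<forall>\<^sub>F n in sequentially. l2_le (proj {k} (Mult g (v n - x))) (e / 2)"
    proof (rule proj_Mult_null[OF g])
      show "finite (reaching_modes A UNIV {k})" if "finite A" for A
        by (rule finite_subset[of _ "(\<lambda>a. k - a) ` A"]) (use that in \<open>force simp: reaching_modes_def\<close>)+
      show "l2_le (v n - x) (B + B)" for n by (rule l2_le_diff[OF v xB])
      show "(\<lambda>n. (v n - x) j) \<longlonglongrightarrow> 0" for j using x[of j] by (simp add: LIM_zero)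
    qed (use \<open>e > 0\<close> in \<open>auto simp: proj_eq_self_iff\<close>)
    then show "\<forall>\<^sub>F n in sequentially. dist (Mult g (v n - x) k) 0 < e"
    proof eventually_elim
      case (elim n)
      then show ?case
        using l2_le_norm[OF elim, of k] \<open>e > 0\<close> by (simp add: proj_def)
    qed
  qed
  moreover have "Mult g (v n - x) k = Mult g (v n) k - Mult g x k" for n
    using Mult_diff_right[OF g l2_le_bounded[OF v] l2_le_bounded[OF xB]] by simp
  ultimately show ?thesis by (simp add: LIM_zero_iff)
qed

definition compression_injective :: "lcoef \<Rightarrow> int set \<Rightarrow> bool" where
  "compression_injective g E \<longleftrightarrow>
     (\<forall>x B. l2_le x B \<longrightarrow> proj E x = x \<longrightarrow> proj E (Mult g x) = 0 \<longrightarrow> x = 0)"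

lemma compression_injective_tendsto_0:
  assumes g: "in_l1 g" and E: "compression_injective g E"
    and v: "\<And>n. l2_le (v n) B" "\<And>n. proj E (v n) = v n" "\<And>j. convergent (\<lambda>n. v n j)"
    and Mult_v: "\<And>k. k \<in> E \<Longrightarrow> (\<lambda>n. Mult g (v n) k) \<longlonglongrightarrow> 0"
  shows "(\<lambda>n. v n j) \<longlonglongrightarrow> 0"
proof -
  define x where "x j = lim (\<lambda>n. v n j)" for j
  have x: "(\<lambda>n. v n j) \<longlonglongrightarrow> x j" for j
    unfolding x_def by (rule convergent_LIMSEQ_iff[THEN iffD1, OF v(3)])
  have "l2_le x B" using x v(1) by (intro l2_le_tendsto[of v B sequentially]) auto
  moreover have "proj E x = x"
    unfolding proj_eq_self_iff
  proof (intro allI impI)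
    fix j assume "j \<notin> E"
    then have "v n j = 0" for n using v(2)[of n] by (simp add: proj_eq_self_iff)
    then show "x j = 0" by (simp add: x_def)
  qed
  moreover have "proj E (Mult g x) = 0"
    using LIMSEQ_unique[OF Mult_tendsto[OF g v(1) x] Mult_v] by (auto simp: proj_def)
  ultimately have "x = 0" using E unfolding compression_injective_def by blast
  then show ?thesis using x[of j] by simp
qed

lemma compression_injective_proj_compl_null:
  assumes g: "in_l1 g" and E: "compression_injective g E"
    and edge: "\<And>A. finite A \<Longrightarrow> finite (reaching_modes A E (- E))"
    and W: "\<And>n. W n \<subseteq> E" "\<And>k. k \<in> E \<Longrightarrow> \<forall>\<^sub>F n in sequentially. k \<in> W n"
    and v: "\<And>n. l2_le (v n) B" "\<And>n. proj (W n) (v n) = v n" "\<And>j. convergent (\<lambda>n. v n j)"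
    and sections: "\<And>n. l2_le (proj (W n) (Mult g (v n))) (\<epsilon> n)" "\<epsilon> \<longlonglongrightarrow> 0" and "e > 0"
  shows "\<forall>\<^sub>F n in sequentially. l2_le (proj (- E) (Mult g (v n))) e"
proof -
  have v_E: "proj E (v n) = v n" for n
    using v(2)[of n] W(1)[of n] unfolding proj_eq_self_iff by blast
  have "(\<lambda>n. Mult g (v n) k) \<longlonglongrightarrow> 0" if "k \<in> E" for k
  proof (rule Lim_null_comparison[OF _ sections(2)])
    show "\<forall>\<^sub>F n in sequentially. cmod (Mult g (v n) k) \<le> \<epsilon> n"
      using W(2)[OF \<open>k \<in> E\<close>]
    proof eventually_elim
      case (elim n)
      then show ?case using l2_le_norm[OF sections(1), of n k] by (simp add: proj_def)
    qed
  qed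
  then have v_0: "(\<lambda>n. v n j) \<longlonglongrightarrow> 0" for j
    by (rule compression_injective_tendsto_0[OF g E v(1) v_E v(3)])
  show ?thesis
    by (rule proj_Mult_null[OF g edge v(1) v_E v_0 \<open>e > 0\<close>])
qed

lemma finite_reaching_modes_negative:
  assumes "finite A"
  shows "finite (reaching_modes A {..<0} (- {..<0}))"
proof (rule finite_subset)
  show "reaching_modes A {..<0} (- {..<0}) \<subseteq> (\<Union>a\<in>A. {- a..<0})"
    by (force simp: reaching_modes_def)
qed (use assms in auto)

lemma finite_reaching_modes_nonnegative:
  assumes "finite A"
  shows "finite (reaching_modes A {0..} (- {0..}))"
proof (rule finite_subset)
  show "reaching_modes A {0..} (- {0..}) \<subseteq> (\<Union>a\<in>A. {0..- a})"
    by (force simp: reaching_modes_def)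
qed (use assms in auto)

text \<open>Seen from its right end, the window \<open>[-m n, -1]\<close> exhausts the negative modes; seen from its left
  end, that is after the shift by \<open>m n\<close>, it exhausts the nonnegative ones.\<close>

lemma Mult_null_if_sections_null:
  assumes g: "in_l1 g" and inj: "compression_injective g {..<0}" "compression_injective g {0..}"
    and m: "filterlim m at_top sequentially"
    and v: "\<And>n. l2_le (v n) B" "\<And>n. proj {- m n..<0} (v n) = v n"
    and conv: "\<And>j. convergent (\<lambda>n. v n j)" "\<And>j. convergent (\<lambda>n. v n (j - m n))"
    and sections: "\<And>n. l2_le (proj {- m n..<0} (Mult g (v n))) (\<epsilon> n)" "\<epsilon> \<longlonglongrightarrow> 0" and "e > 0"
  shows "\<forall>\<^sub>F n in sequentially. l2_le (Mult g (v n)) e"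
proof -
  define w where "w n j = v n (j - m n)" for n j
  have Mult_w: "Mult g (w n) = (\<lambda>k. Mult g (v n) (k - m n))" for n
    unfolding w_def by (rule ext) (rule Mult_shift_right)
  have window: "{i. i + m n \<in> {0..<m n}} = {- m n..<0}" "{i. i + m n \<in> - {0..}} = {..<- m n}" for n
    by auto
  have large_m: "\<forall>\<^sub>F n in sequentially. k < m n" for k
    using m by (simp add: filterlim_at_top flip: add1_zle_eq)
  have right: "\<forall>\<^sub>F n in sequentially. l2_le (proj (- {..<0}) (Mult g (v n))) (e / 3)"
  proof (rule compression_injective_proj_compl_null
        [OF g inj(1) finite_reaching_modes_negative _ _ v conv(1) sections])
    show "\<forall>\<^sub>F n in sequentially. k \<in> {- m n..<0}" if "k \<in> {..<0}" for k
      using large_m[of "- k"] by eventually_elim (use that in auto)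
  qed (use \<open>e > 0\<close> in auto)
  have "\<forall>\<^sub>F n in sequentially. l2_le (proj (- {0..}) (Mult g (w n))) (e / 3)"
  proof (rule compression_injective_proj_compl_null
        [OF g inj(2) finite_reaching_modes_nonnegative _ _ _ _ _ _ sections(2)])
    show "\<forall>\<^sub>F n in sequentially. k \<in> {0..<m n}" if "k \<in> {0..}" for k
      using large_m[of k] by eventually_elim (use that in auto)
    show "l2_le (w n) B" "proj {0..<m n} (w n) = w n" "convergent (\<lambda>n. w n j)"
      "l2_le (proj {0..<m n} (Mult g (w n))) (\<epsilon> n)" for n j
      unfolding Mult_w unfolding w_def proj_shift window v(2)
      by (intro l2_le_shift v(1) refl conv(2) sections(1))+
  qed (use \<open>e > 0\<close> in auto)
  then have left: "\<forall>\<^sub>F n in sequentially. l2_le (proj {..<- m n} (Mult g (v n))) (e / 3)"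
    unfolding Mult_w proj_shift window l2_le_shift_iff .
  have "\<forall>\<^sub>F n in sequentially. \<epsilon> n < e / 3"
    using sections(2) by (rule order_tendstoD(2)) (use \<open>e > 0\<close> in simp)
  with right left large_m[of 0] show ?thesis
  proof eventually_elim
    case (elim n)
    have "Mult g (v n) = proj (- {..<0}) (Mult g (v n)) + proj {..<- m n} (Mult g (v n))
        + proj {- m n..<0} (Mult g (v n))"
      using \<open>0 < m n\<close> by (auto simp: proj_def fun_eq_iff)
    then have "l2_le (Mult g (v n)) (e / 3 + e / 3 + e / 3)"
      using l2_le_add[OF l2_le_add[OF elim(1,2)] l2_le_mono[OF sections(1) less_imp_le[OF elim(4)]]]
      by metis
    then show ?case by simp
  qed
qed

lemma pointwise_convergent_subsequence:
  fixes v w :: "nat \<Rightarrow> 'a::countable \<Rightarrow> 'b::{real_normed_vector, heine_borel}"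
  assumes "\<And>n j. norm (v n j) \<le> B" "\<And>n j. norm (w n j) \<le> B"
  obtains r where "strict_mono r" "\<And>j. convergent (\<lambda>n. v (r n) j)" "\<And>j. convergent (\<lambda>n. w (r n) j)"
proof -
  define f where "f n p = (case p of Inl j \<Rightarrow> v n j | Inr j \<Rightarrow> w n j)" for n and p :: "'a + 'a"
  have "norm (f n p) \<le> B" for n p
    using assms by (simp add: f_def split: sum.split)
  then obtain r where "strict_mono r" and conv: "\<And>p. \<exists>l. (\<lambda>n. f (r n) p) \<longlonglongrightarrow> l"
    using function_convergent_subsequence[of UNIV f B] by (metis UNIV_I countableI_type)
  then show thesis
    using that[OF \<open>strict_mono r\<close>] conv[of "Inl _"] conv[of "Inr _"] by (simp add: f_def convergent_def)
qed

abbreviation section_stable :: "lcoef \<Rightarrow> int \<Rightarrow> real \<Rightarrow> bool" where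
  "section_stable g M \<kappa> \<equiv>
     l2_stable \<kappa> {v. proj {- M..<0} v = v} (\<lambda>v. proj {- M..<0} (Mult g v))"

lemma not_section_stable_normalized:
  assumes "\<not> section_stable g M \<kappa>" "\<kappa> > 0"
  obtains w where "proj {- M..<0} w = w" "l2_le w 1" "\<not> l2_le w (1 / 2)"
    "l2_le (proj {- M..<0} (Mult g w)) (1 / \<kappa>)"
proof -
  obtain v B where v: "proj {- M..<0} v = v" "\<not> l2_le v (\<kappa> * B)"
    and B: "l2_le (proj {- M..<0} (Mult g v)) B"
    using assms(1) by (auto simp: l2_stable_def)
  define L where "L = L2_set (\<lambda>j. cmod (v j)) {- M..<0}"
  define w where "w = (\<lambda>j. complex_of_real (1 / L) * v j)"
  have v_L: "l2_le v L" using l2_le_proj_finite[of "{- M..<0}" v] v(1) by (simp add: L_def)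
  have L: "\<kappa> * B < L" using v(2) l2_le_mono[OF v_L] by (meson not_le)
  moreover have "0 \<le> \<kappa> * B" using l2_le_nonneg[OF B] assms(2) by simp
  ultimately have "L > 0" by linarith
  have l2_le_w: "l2_le w (1 / L * C) \<longleftrightarrow> l2_le v C" for C
    using l2_le_mult_iff[of "complex_of_real (1 / L)" v C] \<open>L > 0\<close> by (simp add: w_def norm_divide)
  show thesis
  proof (rule that[of w])
    show "proj {- M..<0} w = w" using v(1) by (simp add: proj_eq_self_iff w_def)
    show "l2_le w 1" using l2_le_w[of L] v_L \<open>L > 0\<close> by simp
    show "\<not> l2_le w (1 / 2)"
      using l2_le_w[of "L / 2"] l2_leD[of v "L / 2" "{- M..<0}"] \<open>L > 0\<close> by (auto simp: L_def)
    have "proj {- M..<0} (Mult g w) = (\<lambda>k. complex_of_real (1 / L) * proj {- M..<0} (Mult g v) k)"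
      unfolding w_def Mult_scale_right by (auto simp: proj_def)
    then have "l2_le (proj {- M..<0} (Mult g w)) (1 / L * B)"
      using l2_le_mult[OF B, of "complex_of_real (1 / L)"] \<open>L > 0\<close> by (simp add: norm_divide)
    moreover have "1 / L * B \<le> 1 / \<kappa>" using L \<open>L > 0\<close> assms(2) by (simp add: field_simps)
    ultimately show "l2_le (proj {- M..<0} (Mult g w)) (1 / \<kappa>)" by (rule l2_le_mono)
  qed
qed

theorem (in nonvanishing_symbol) finite_sections_stable:
  assumes inj: "compression_injective g {..<0}" "compression_injective g {0..}"
  shows "\<exists>\<kappa>>0. \<forall>\<^sub>F M in at_top. section_stable g M \<kappa>"
proof (rule ccontr)
  assume unstable: "\<not> ?thesis"
  have "\<exists>M v. M \<ge> int n \<and> proj {- M..<0} v = v \<and> l2_le v 1 \<and> \<not> l2_le v (1 / 2) \<and>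
      l2_le (proj {- M..<0} (Mult g v)) (1 / Suc n)" for n
  proof -
    have "real (Suc n) > 0" by simp
    then have "\<not> (\<forall>\<^sub>F M in at_top. section_stable g M (Suc n))" using unstable by blast
    then obtain M where M: "M \<ge> int n" and not_stable: "\<not> section_stable g M (Suc n)"
      by (auto simp: eventually_at_top_linorder)
    obtain v where "proj {- M..<0} v = v" "l2_le v 1" "\<not> l2_le v (1 / 2)"
      "l2_le (proj {- M..<0} (Mult g v)) (1 / Suc n)"
      by (rule not_section_stable_normalized[OF not_stable]) simp
    with M show ?thesis by blast
  qed
  then obtain M v where M: "\<And>n. M n \<ge> int n"
    and v: "\<And>n. proj {- M n..<0} (v n) = v n" "\<And>n. l2_le (v n) 1" "\<And>n. \<not> l2_le (v n) (1 / 2)"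
    and sections: "\<And>n. l2_le (proj {- M n..<0} (Mult g (v n))) (1 / Suc n)"
    by metis
  obtain r where r: "strict_mono r"
    and conv: "\<And>j. convergent (\<lambda>n. v (r n) j)" "\<And>j. convergent (\<lambda>n. v (r n) (j - M (r n)))"
    using pointwise_convergent_subsequence[of v 1 "\<lambda>n j. v n (j - M n)"] l2_le_norm[OF v(2)] by metis
  have "filterlim M at_top sequentially"
    by (rule filterlim_at_top_mono[OF filterlim_int_sequentially]) (use M in simp)
  then have M_r: "filterlim (\<lambda>n. M (r n)) at_top sequentially"
    by (rule filterlim_compose[OF _ filterlim_subseq[OF r]])
  have "(\<lambda>n. 1 / Suc (r n)) \<longlonglongrightarrow> 0"
    using LIMSEQ_subseq_LIMSEQ[OF LIMSEQ_inverse_real_of_nat r] by (simp add: o_def inverse_eq_divide)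
  then have "\<forall>\<^sub>F n in sequentially. l2_le (Mult g (v (r n))) (\<delta> / 2)"
    by (intro Mult_null_if_sections_null[OF g_l1 inj M_r v(2) v(1) conv sections]) (use \<delta>_pos in auto)
  then obtain n where "l2_le (Mult g (v (r n))) (\<delta> / 2)"
    by (auto simp: eventually_sequentially)
  then have "l2_le (v (r n)) (1 / 2)"
    using Mult_bounded_below[OF v(2)] \<delta>_pos by force
  with v(3) show False by simp
qed

section \<open>Injective endomorphisms of finitely supported families\<close>

lemma (in vector_space) linear_inj_on_imp_image_eq:
  assumes f: "Vector_Spaces.linear scale scale f" "inj_on f V" "f ` V \<subseteq> V"
    and V: "subspace V" "finite E" "V \<subseteq> span E"
  shows "f ` V = V"
proof (rule ccontr)
  interpret f: Vector_Spaces.linear scale scale f by (rule f(1))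
  assume "f ` V \<noteq> V"
  obtain B where B: "B \<subseteq> V" "independent B" "V \<subseteq> span B"
    by (rule basis_exists)
  have span_B: "span B = V"
    by (rule subset_antisym[OF span_minimal[OF B(1) V(1)] B(3)])
  have "finite B"
    using independent_span_bound[OF V(2) B(2) order_trans[OF B(1) V(3)]] by simp
  obtain y where y: "y \<in> V" "y \<notin> f ` V"
    using f(3) \<open>f ` V \<noteq> V\<close> by blast
  have "independent (f ` B)"
    using f.independent_injective_image[OF B(2)] f(2) by (simp add: span_B)
  then have independent: "independent (insert y (f ` B))"
    using y(2) by (intro independent_insertI) (simp_all add: f.span_image span_B)
  have "insert y (f ` B) \<subseteq> span B"
    unfolding span_B using y(1) f(3) B(1) by blast
  then have "card (insert y (f ` B)) \<le> card B"
    using independent_span_bound[OF \<open>finite B\<close> independent] by simp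
  moreover have "y \<notin> f ` B" using y(2) B(1) by blast
  moreover have "card (f ` B) = card B"
    by (rule card_image[OF inj_on_subset[OF f(2) B(1)]])
  ultimately show False using \<open>finite B\<close> by simp
qed

definition lcoef_scale :: "complex \<Rightarrow> lcoef \<Rightarrow> lcoef" where
  "lcoef_scale a u = (\<lambda>j. a * u j)"

interpretation lcoef: vector_space lcoef_scale
  by unfold_locales (auto simp: lcoef_scale_def fun_eq_iff algebra_simps)

lemma finite_support_subset_span:
  assumes "finite S"
  shows "{v. proj S v = v} \<subseteq> lcoef.span ((\<lambda>i. proj {i} (\<lambda>_. 1)) ` S)"
proof
  fix v :: lcoef assume "v \<in> {v. proj S v = v}"
  have "proj T v \<in> lcoef.span ((\<lambda>i. proj {i} (\<lambda>_. 1)) ` S)" if "finite T" "T \<subseteq> S" for T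
    using that
  proof (induction T rule: finite_induct)
    case empty
    have proj_empty: "proj {} v = 0" by (simp add: proj_def fun_eq_iff)
    show ?case unfolding proj_empty by (rule lcoef.span_zero)
  next
    case (insert i T)
    have "proj (insert i T) v = lcoef_scale (v i) (proj {i} (\<lambda>_. 1)) + proj T v"
      using insert.hyps by (auto simp: proj_def lcoef_scale_def fun_eq_iff)
    also have "\<dots> \<in> lcoef.span ((\<lambda>i. proj {i} (\<lambda>_. 1)) ` S)"
      using insert.prems by (intro lcoef.span_add lcoef.span_scale lcoef.span_base insert.IH) auto
    finally show ?case .
  qed
  from this[OF assms] show "v \<in> lcoef.span ((\<lambda>i. proj {i} (\<lambda>_. 1)) ` S)"
    using \<open>v \<in> {v. proj S v = v}\<close> by simp
qed

lemma bij_betw_finite_support: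
  assumes "finite S" and f: "Vector_Spaces.linear lcoef_scale lcoef_scale f"
    and range: "\<And>v. proj S v = v \<Longrightarrow> proj S (f v) = f v"
    and kernel: "\<And>v. proj S v = v \<Longrightarrow> f v = 0 \<Longrightarrow> v = 0"
  shows "bij_betw f {v. proj S v = v} {v. proj S v = v}"
proof -
  interpret f: Vector_Spaces.linear lcoef_scale lcoef_scale f by (rule f)
  have subspace: "lcoef.subspace {v. proj S v = v}"
    by (simp add: lcoef.subspace_def proj_eq_self_iff lcoef_scale_def)
  have inj: "inj_on f {v. proj S v = v}"
  proof (rule inj_onI)
    fix u v assume uv: "u \<in> {v. proj S v = v}" "v \<in> {v. proj S v = v}" "f u = f v"
    have "proj S (u - v) = u - v" using uv(1,2) by (simp add: proj_diff)
    moreover have "f (u - v) = 0" using uv(3) by (simp add: f.diff)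
    ultimately have "u - v = 0" by (rule kernel)
    then show "u = v" by simp
  qed
  have "f ` {v. proj S v = v} \<subseteq> {v. proj S v = v}"
    by (rule image_subsetI) (simp add: range)
  from lcoef.linear_inj_on_imp_image_eq[OF f inj this subspace _ finite_support_subset_span[OF assms(1)]]
  show ?thesis using assms(1) inj by (simp add: bij_betw_def)
qed

section \<open>Weighted norms\<close>

abbreviation weight :: "int \<Rightarrow> real" where
  "weight j \<equiv> max 1 \<bar>real_of_int j\<bar>"

definition weighted :: "real \<Rightarrow> lcoef \<Rightarrow> lcoef" where
  "weighted s u = (\<lambda>j. complex_of_real (weight j powr s) * u j)"

lemma weighted_0: "weighted 0 u = u"
proof
  have "weight j \<noteq> 0" for j by linarith
  then show "weighted 0 u j = u j" for j by (simp add: weighted_def)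
qed

lemma weighted_diff: "weighted s (u - v) = weighted s u - weighted s v"
  by (simp add: weighted_def fun_eq_iff right_diff_distrib)

lemma norm_weighted_sq: "(cmod (weighted s u j))\<^sup>2 = (cmod (u j))\<^sup>2 * weight j powr (2 * s)"
  by (simp add: weighted_def norm_mult power_mult_distrib powr_power mult.commute)

lemma in_Hs_iff_l2_le: "in_Hs s u \<longleftrightarrow> (\<exists>B. l2_le (weighted s u) B)"
proof
  assume u: "in_Hs s u"
  have "0 \<le> (\<Sum>\<^sub>\<infinity>j. (cmod (u j))\<^sup>2 * weight j powr (2 * s))" by (intro infsum_nonneg) simp
  then have "l2_le (weighted s u) (sqrt (\<Sum>\<^sub>\<infinity>j. (cmod (u j))\<^sup>2 * weight j powr (2 * s)))"
    using u by (simp add: l2_le_iff norm_weighted_sq in_Hs_def)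
  then show "\<exists>B. l2_le (weighted s u) B" ..
qed (auto simp: l2_le_iff norm_weighted_sq in_Hs_def)

lemma in_Hs_0_iff_l2_le: "in_Hs 0 u \<longleftrightarrow> (\<exists>B. l2_le u B)"
  by (simp add: in_Hs_iff_l2_le weighted_0)

lemma Hs_norm_le:
  assumes "l2_le (weighted s u) B" "c \<bar>s\<bar> \<ge> 0"
  shows "Hs_norm c s u \<le> sqrt (c \<bar>s\<bar>) * B"
proof -
  have "Hs_norm c s u \<le> sqrt (c \<bar>s\<bar> * B\<^sup>2)"
    unfolding Hs_norm_def using assms
    by (intro real_sqrt_le_mono mult_left_mono) (simp_all add: l2_le_iff norm_weighted_sq)
  also have "\<dots> = sqrt (c \<bar>s\<bar>) * B"
    using l2_le_nonneg[OF assms(1)] by (simp add: real_sqrt_mult)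
  finally show ?thesis .
qed

lemma l2_le_weighted_mono:
  assumes "l2_le (weighted t u) B" "0 \<le> a"
    and "\<And>j. u j \<noteq> 0 \<Longrightarrow> weight j powr s \<le> a * weight j powr t"
  shows "l2_le (weighted s u) (a * B)"
proof (rule l2_le_dominated)
  show "l2_le (\<lambda>j. complex_of_real a * weighted t u j) (a * B)"
    using l2_le_mult[OF assms(1), of "complex_of_real a"] assms(2) by simp
  show "cmod (weighted s u j) \<le> cmod (complex_of_real a * weighted t u j)" for j
  proof (cases "u j = 0")
    case False
    show ?thesis
      using mult_right_mono[OF assms(3)[OF False], of "cmod (u j)"] assms(2)
      by (simp add: weighted_def norm_mult mult.assoc)
  qed (simp add: weighted_def)
qed

lemma summable_on_int:
  fixes f :: "int \<Rightarrow> real"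
  assumes "(\<lambda>n. f (int n)) summable_on UNIV" "(\<lambda>n. f (- int n)) summable_on UNIV"
  shows "f summable_on UNIV"
proof -
  have "f summable_on range int" "f summable_on range (\<lambda>n. - int n)"
    using assms by (subst summable_on_reindex; simp add: inj_def o_def)+
  moreover have "j \<in> range int \<union> range (\<lambda>n. - int n)" for j
    by (cases j rule: int_cases2) auto
  then have "range int \<union> range (\<lambda>n. - int n) = UNIV" by blast
  ultimately show ?thesis using summable_on_union by metis
qed

lemma summable_weight_powr:
  assumes "a < - 1"
  shows "(\<lambda>j. weight j powr a) summable_on UNIV"
proof (rule summable_on_int)
  have "summable (\<lambda>n. real n powr a)" using assms by (simp add: summable_real_powr_iff)
  then have "summable (\<lambda>n. weight (int n) powr a)"
    by (rule summable_cong[THEN iffD1, rotated])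
       (use eventually_ge_at_top[of 1] in eventually_elim, simp add: max_absorb2)
  then show "(\<lambda>n. weight (int n) powr a) summable_on UNIV"
    by (simp add: summable_on_UNIV_nonneg_real_iff)
  then show "(\<lambda>n. weight (- int n) powr a) summable_on UNIV" by simp
qed

lemma in_Hs_imp_in_l1:
  assumes "t > 1 / 2" "in_Hs t u"
  shows "in_l1 u"
proof (rule Infinite_Sum.abs_summable_on_comparison_test')
  show "(\<lambda>j. (cmod (u j))\<^sup>2 * weight j powr (2 * t) + weight j powr (- 2 * t)) summable_on UNIV"
    using assms unfolding in_Hs_def by (intro summable_on_add summable_weight_powr) auto
  fix j
  let ?a = "cmod (u j) * weight j powr t" and ?b = "weight j powr - t"
  have "?a * ?b \<le> ?a\<^sup>2 + ?b\<^sup>2"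
    using sum_squares_bound[of ?a ?b] zero_le_power2[of ?a] zero_le_power2[of ?b] by linarith
  moreover have "?a * ?b = cmod (u j)" by (simp add: powr_minus)
  moreover have "?a\<^sup>2 = (cmod (u j))\<^sup>2 * weight j powr (2 * t)" "?b\<^sup>2 = weight j powr (- 2 * t)"
    by (simp_all add: power_mult_distrib powr_power mult.commute)
  ultimately show "cmod (u j) \<le> (cmod (u j))\<^sup>2 * weight j powr (2 * t) + weight j powr (- 2 * t)"
    by simp
qed

section \<open>The truncated operators\<close>

definition modes :: "nat \<Rightarrow> int set" where
  "modes N = {- Nminus N..Nplus N}"

lemma finite_modes: "finite (modes N)"
  by (simp add: modes_def)

lemma negative_modes: "{..<0} \<inter> modes N = {- Nminus N..<0}"
  by (auto simp: modes_def Nplus_def)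

lemma PN_eq_proj: "PN N u = proj (modes N) u"
  by (auto simp: PN_def proj_def modes_def)

lemma ranPN_eq: "ranPN N = {v. proj (modes N) v = v}"
proof (intro set_eqI iffI)
  fix v :: lcoef assume "v \<in> {v. proj (modes N) v = v}"
  then show "v \<in> ranPN N" unfolding ranPN_def PN_eq_proj by (metis (mono_tags) mem_Collect_eq rangeI)
qed (auto simp: ranPN_def PN_eq_proj proj_proj)

lemma Cplus_eq_proj: "Cplus u = proj {0..} u"
  by (auto simp: Cplus_def proj_def)

lemma Cminus_eq_proj: "Cminus u = - proj {..<0} u"
  by (auto simp: Cminus_def proj_def)

lemma AN_eq_proj:
  assumes "v \<in> ranPN N"
  shows "AN N g v = proj {0..} v + proj (modes N) (Mult g (proj {..<0} v))"
proof -
  have "proj (modes N) (Cminus v) = Cminus v"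
    using assms by (auto simp: ranPN_eq proj_eq_self_iff Cminus_def)
  then have "AN N g v = Cplus v - proj (modes N) (- Mult g (proj {..<0} v))"
    by (simp add: AN_def MN_def PN_eq_proj Cminus_eq_proj Mult_uminus_right)
  also have "\<dots> = proj {0..} v + proj (modes N) (Mult g (proj {..<0} v))"
    by (auto simp: Cplus_eq_proj proj_def)
  finally show ?thesis .
qed

lemma AN_in_ranPN: "v \<in> ranPN N \<Longrightarrow> AN N g v \<in> ranPN N"
  by (auto simp: AN_eq_proj ranPN_eq proj_eq_self_iff proj_apply)

lemma AN_apply:
  "AN N g v k = Cplus v k - (if k \<in> modes N then \<Sum>j\<in>modes N. g (k - j) * Cminus v j else 0)"
  by (simp add: AN_def MN_def PN_eq_proj proj_apply[of _ "Mult _ _"] Mult_proj_right finite_modes)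

lemma linear_AN: "Vector_Spaces.linear lcoef_scale lcoef_scale (AN N g)"
  unfolding Vector_Spaces.linear_iff
proof (intro conjI allI lcoef.vector_space_axioms ext)
  fix u v :: lcoef and a :: complex and k :: int
  have add: "Cplus (u + v) j = Cplus u j + Cplus v j" "Cminus (u + v) j = Cminus u j + Cminus v j" for j
    by (simp_all add: Cplus_def Cminus_def)
  show "AN N g (u + v) k = (AN N g u + AN N g v) k"
    by (simp add: AN_apply add distrib_left sum.distrib)
  have scale: "Cplus (lcoef_scale a v) j = a * Cplus v j"
    "Cminus (lcoef_scale a v) j = a * Cminus v j" for j
    by (simp_all add: Cplus_def Cminus_def lcoef_scale_def)
  show "AN N g (lcoef_scale a v) k = lcoef_scale a (AN N g v) k"
    unfolding lcoef_scale_def[of a "AN N g v"]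
    by (simp add: AN_apply scale right_diff_distrib sum_distrib_left mult.left_commute)
qed

lemma bij_betw_AN:
  assumes "l2_stable \<kappa> (ranPN N) (AN N g)"
  shows "bij_betw (AN N g) (ranPN N) (ranPN N)"
  unfolding ranPN_eq
proof (rule bij_betw_finite_support[OF finite_modes linear_AN])
  fix v :: lcoef assume "proj (modes N) v = v"
  then have v: "v \<in> ranPN N" by (simp add: ranPN_eq)
  show "proj (modes N) (AN N g v) = AN N g v"
    using AN_in_ranPN[OF v] by (simp add: ranPN_eq)
  show "v = 0" if "AN N g v = 0"
    by (rule l2_stable_kernel[OF assms, OF v that])
qed

lemma weight_outside_modes:
  assumes "j \<notin> modes N"
  shows "real N / 2 \<le> weight j"
proof -
  have "int N \<le> 2 * \<bar>j\<bar>" using assms unfolding modes_def Nminus_def Nplus_def by auto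
  then have "real N \<le> 2 * \<bar>real_of_int j\<bar>" by linarith
  then show ?thesis by linarith
qed

lemma weight_inside_modes:
  assumes "j \<in> modes N" "N \<ge> 1"
  shows "weight j \<le> real N"
proof -
  have "\<bar>j\<bar> \<le> int N" using assms(1) unfolding modes_def Nminus_def Nplus_def by auto
  then have "\<bar>real_of_int j\<bar> \<le> real N" by linarith
  then show ?thesis using assms(2) by simp
qed

lemma truncation_error:
  assumes u: "l2_le (weighted t u) U" and "s \<le> t" "N \<ge> 1"
  shows "l2_le (weighted s (u - PN N u)) ((real N / 2) powr (s - t) * U)"
proof (rule l2_le_weighted_mono)
  show "l2_le (weighted t (u - PN N u)) U"
    by (rule l2_le_dominated[OF u]) (simp add: weighted_def PN_def norm_mult)
  fix j assume "(u - PN N u) j \<noteq> 0"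
  then have "j \<notin> modes N" by (auto simp: PN_eq_proj proj_def)
  have "weight j powr s = weight j powr (s - t) * weight j powr t"
    by (simp add: powr_add[symmetric])
  also have "\<dots> \<le> (real N / 2) powr (s - t) * weight j powr t"
    using weight_outside_modes[OF \<open>j \<notin> modes N\<close>] assms(2,3)
    by (intro mult_right_mono powr_mono2') auto
  finally show "weight j powr s \<le> (real N / 2) powr (s - t) * weight j powr t" .
qed simp

lemma bernstein_inequality:
  assumes "l2_le e B" "e \<in> ranPN N" "s \<ge> 0" "N \<ge> 1"
  shows "l2_le (weighted s e) (real N powr s * B)"
proof (rule l2_le_weighted_mono)
  show "l2_le (weighted 0 e) B" using assms(1) by (simp add: weighted_0)
  fix j assume "e j \<noteq> 0"
  then have "j \<in> modes N" using assms(2) by (auto simp: ranPN_eq proj_eq_self_iff)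
  then have "weight j powr s \<le> real N powr s"
    using weight_inside_modes assms(3,4) by (intro powr_mono2) auto
  moreover have "weight j \<noteq> 0" by linarith
  ultimately show "weight j powr s \<le> real N powr s * weight j powr 0" by simp
qed simp

lemma filterlim_Nminus: "filterlim Nminus at_top sequentially"
  unfolding filterlim_at_top
proof
  show "\<forall>\<^sub>F N in sequentially. Z \<le> Nminus N" for Z
    using eventually_ge_at_top[of "nat (2 * Z)"] by eventually_elim (unfold Nminus_def, linarith)
qed

text \<open>\<open>AN N g\<close> is block triangular: its negative modes only see those of \<open>v\<close>, through a section
  of the Toeplitz operator.\<close>

lemma section_stable_imp_AN_stable:
  assumes g: "in_l1 g" and stable: "section_stable g (Nminus N) \<kappa>"
  shows "l2_stable (1 + l1_norm g * \<kappa> + \<kappa>) (ranPN N) (AN N g)"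
  unfolding l2_stable_def
proof (intro ballI allI impI)
  fix v B assume v: "v \<in> ranPN N" and B: "l2_le (AN N g v) B"
  define q where "q = proj {..<0} v"
  have AN_v: "AN N g v = proj {0..} v + proj (modes N) (Mult g q)"
    unfolding q_def by (rule AN_eq_proj[OF v])
  have "proj {- Nminus N..<0} (AN N g v) = proj {- Nminus N..<0} (Mult g q)"
    unfolding AN_v negative_modes[symmetric] by (auto simp: proj_def)
  then have "l2_le (proj {- Nminus N..<0} (Mult g q)) B"
    using l2_le_proj[OF B] by metis
  moreover have "proj {- Nminus N..<0} q = q"
    using v by (auto simp: q_def ranPN_eq proj_eq_self_iff proj_apply modes_def)
  ultimately have q: "l2_le q (\<kappa> * B)"
    using l2_stableD[OF stable, of q B] by simp
  have "proj {0..} v = AN N g v - proj (modes N) (Mult g q)" by (simp add: AN_v)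
  then have "l2_le (proj {0..} v) (B + l1_norm g * (\<kappa> * B))"
    using l2_le_diff[OF B l2_le_proj[OF l2_le_Mult[OF g q]]] by simp
  moreover have "v = proj {0..} v + q" by (auto simp: q_def proj_def)
  ultimately have "l2_le v (B + l1_norm g * (\<kappa> * B) + \<kappa> * B)"
    using l2_le_add[OF _ q] by metis
  then show "l2_le v ((1 + l1_norm g * \<kappa> + \<kappa>) * B)" by (simp add: algebra_simps)
qed

section \<open>The Riemann--Hilbert problem\<close>

lemma RHP_sol_iff:
  "RHP_sol g u \<longleftrightarrow> (\<exists>B. l2_le u B) \<and> proj {0..} u + Mult g (proj {..<0} u) = g - one_c"
  by (simp add: RHP_sol_def in_Hs_0_iff_l2_le Cplus_eq_proj Cminus_eq_proj Mult_uminus_right)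

locale uniquely_solvable_RHP = nonvanishing_symbol +
  fixes u :: lcoef
  assumes u_l1: "in_l1 u"
    and solution: "RHP_sol g u"
    and unique: "RHP_sol g v \<Longrightarrow> v = u"
begin

lemma homogeneous_RHP_trivial:
  assumes w: "l2_le w B" "proj {0..} w + Mult g (proj {..<0} w) = 0"
  shows "w = 0"
proof -
  obtain C where u: "l2_le u C" "proj {0..} u + Mult g (proj {..<0} u) = g - one_c"
    using solution by (auto simp: RHP_sol_iff)
  have "proj {0..} (u + w) + Mult g (proj {..<0} (u + w))
      = (proj {0..} u + Mult g (proj {..<0} u)) + (proj {0..} w + Mult g (proj {..<0} w))"
    using Mult_add_right[OF g_l1 l2_le_bounded[OF l2_le_proj[OF u(1)]]
        l2_le_bounded[OF l2_le_proj[OF w(1)]]]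
    by (simp add: proj_add)
  then have "RHP_sol g (u + w)"
    using l2_le_add[OF u(1) w(1)] u(2) w(2) by (auto simp: RHP_sol_iff)
  then show ?thesis using unique[of "u + w"] by simp
qed

lemma compression_injective_negative: "compression_injective g {..<0}"
  unfolding compression_injective_def
proof (intro allI impI)
  fix x B assume x: "l2_le x B" "proj {..<0} x = x" "proj {..<0} (Mult g x) = 0"
  have x_nonneg: "x j = 0" if "j \<ge> 0" for j
    using x(2) that by (simp add: proj_eq_self_iff)
  have gx_neg: "Mult g x j = 0" if "j < 0" for j
    using fun_cong[OF x(3), of j] that by (simp add: proj_def)
  define w where "w = x - Mult g x"
  have w: "proj {0..} w = - Mult g x" "proj {..<0} w = x"
    by (auto simp: proj_def w_def fun_eq_iff x_nonneg gx_neg)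
  have "l2_le w (B + l1_norm g * B)"
    unfolding w_def by (rule l2_le_diff[OF x(1) l2_le_Mult[OF g_l1 x(1)]])
  moreover have "proj {0..} w + Mult g (proj {..<0} w) = 0"
    unfolding w by (rule left_minus)
  ultimately have "w = 0" by (rule homogeneous_RHP_trivial)
  have "x = proj {..<0} w" by (rule w(2)[symmetric])
  also have "\<dots> = 0" by (simp add: \<open>w = 0\<close> proj_def fun_eq_iff)
  finally show "x = 0" .
qed

lemma jump_relation:
  "in_l1 (one_c + Cminus u)" "Mult g (one_c + Cminus u) = one_c + Cplus u"
proof -
  have one: "in_l1 one_c" by (rule in_l1_finite_support[of "{0}"]) (auto simp: one_c_def)
  have Cminus: "in_l1 (Cminus u)" by (rule in_l1_dominated[OF u_l1]) (simp add: Cminus_def)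
  show "in_l1 (one_c + Cminus u)" by (rule in_l1_add[OF one Cminus])
  have "Mult g (one_c + Cminus u) = g + Mult g (Cminus u)"
    by (simp only: Mult_one_right Mult_add_right[OF g_l1 in_l1_bounded[OF one] in_l1_bounded[OF Cminus]])
  also have "\<dots> = one_c + (g - one_c) + Mult g (Cminus u)" by simp
  also have "g - one_c = Cplus u - Mult g (Cminus u)"
    using solution by (simp add: RHP_sol_def)
  also have "one_c + (Cplus u - Mult g (Cminus u)) + Mult g (Cminus u) = one_c + Cplus u"
    by (simp add: add.assoc)
  finally show "Mult g (one_c + Cminus u) = one_c + Cplus u" .
qed

text \<open>If \<open>g y\<close> has only negative modes, then so has \<open>\<phi>\<^sup>- g y = \<phi>\<^sup>+ y\<close>, which on the other
  hand has only nonnegative modes. As \<open>\<phi>\<^sup>- = 1 + O(1/z)\<close> is invertible as a formal series in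
  \<open>1/z\<close>, this forces \<open>g y = 0\<close>.\<close>

lemma compression_injective_nonnegative: "compression_injective g {0..}"
  unfolding compression_injective_def
proof (intro allI impI)
  fix y B assume y: "l2_le y B" "proj {0..} y = y" "proj {0..} (Mult g y) = 0"
  have y_neg: "y j = 0" if "j < 0" for j
    using y(2) that by (simp add: proj_eq_self_iff)
  have gy_nonneg: "Mult g y j = 0" if "j \<ge> 0" for j
    using fun_cong[OF y(3), of j] that by (simp add: proj_def)
  define \<phi>\<^sub>m where "\<phi>\<^sub>m = one_c + Cminus u"
  have jump: "Mult \<phi>\<^sub>m (Mult g y) = Mult (one_c + Cplus u) y"
    using Mult_assoc[OF jump_relation(1) g_l1 l2_le_bounded[OF y(1)]]
    by (simp only: \<phi>\<^sub>m_def Mult_commute[of _ g] jump_relation(2))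
  have "Mult \<phi>\<^sub>m (Mult g y) k = 0" for k
  proof (cases "k < 0")
    case True
    then show ?thesis
      unfolding jump by (intro Mult_eq_0) (auto simp: one_c_def Cplus_def y_neg)
  next
    case False
    then show ?thesis
      by (intro Mult_eq_0) (auto simp: \<phi>\<^sub>m_def one_c_def Cminus_def gy_nonneg)
  qed
  then have "Mult \<phi>\<^sub>m (Mult g y) = 0" by (simp add: fun_eq_iff)
  then have "Mult g y = 0"
    by (rule triangular_Mult_injective[of \<phi>\<^sub>m 0, rotated -1])
       (auto simp: \<phi>\<^sub>m_def one_c_def Cminus_def gy_nonneg)
  then show "y = 0" by (rule Mult_eq_0_imp_eq_0[OF y(1)])
qed

lemma eventually_AN_stable: "\<exists>\<kappa>. \<forall>\<^sub>F N in sequentially. l2_stable \<kappa> (ranPN N) (AN N g)"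
proof -
  obtain \<kappa> where stable: "\<forall>\<^sub>F M in at_top. section_stable g M \<kappa>"
    using finite_sections_stable[OF compression_injective_negative compression_injective_nonnegative]
    by blast
  have "\<forall>\<^sub>F N in sequentially. section_stable g (Nminus N) \<kappa>"
    by (rule eventually_compose_filterlim[OF stable filterlim_Nminus])
  then have "\<forall>\<^sub>F N in sequentially. l2_stable (1 + l1_norm g * \<kappa> + \<kappa>) (ranPN N) (AN N g)"
    by eventually_elim (rule section_stable_imp_AN_stable[OF g_l1])
  then show ?thesis ..
qed

lemma truncation_residual:
  "PN N (g - one_c) - AN N g (PN N u) = PN N (Mult g (proj {..<0} (u - PN N u)))"
proof -
  obtain C where u: "l2_le u C" "proj {0..} u + Mult g (proj {..<0} u) = g - one_c"
    using solution by (auto simp: RHP_sol_iff)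
  have bounded: "bounded (range (proj S (proj T u)))" for S T
    by (rule l2_le_bounded[OF l2_le_proj[OF l2_le_proj[OF u(1)]]])
  have "PN N u \<in> ranPN N" by (simp add: ranPN_def)
  then have "PN N (g - one_c) - AN N g (PN N u) = PN N (proj {0..} u + Mult g (proj {..<0} u)) -
      (proj {0..} (PN N u) + PN N (Mult g (proj {..<0} (PN N u))))"
    by (simp add: u(2) AN_eq_proj PN_eq_proj)
  also have "\<dots> = PN N (Mult g (proj {..<0} u) - Mult g (proj {..<0} (PN N u)))"
    by (simp add: PN_eq_proj proj_add proj_diff proj_proj Int_commute)
  also have "Mult g (proj {..<0} u) - Mult g (proj {..<0} (PN N u)) = Mult g (proj {..<0} (u - PN N u))"
    using Mult_diff_right[OF g_l1 bounded[of "{..<0}" UNIV] bounded[of "{..<0}" "modes N"]]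
    by (simp add: proj_diff PN_eq_proj proj_proj)
  finally show ?thesis .
qed

lemma AN_truncation_defect:
  assumes u\<^sub>N: "u\<^sub>N \<in> ranPN N" "AN N g u\<^sub>N = PN N (g - one_c)" and R: "l2_le (u - PN N u) R"
  shows "l2_le (AN N g (u\<^sub>N - PN N u)) (l1_norm g * R)"
proof -
  interpret AN: Vector_Spaces.linear lcoef_scale lcoef_scale "AN N g" by (rule linear_AN)
  have "AN N g (u\<^sub>N - PN N u) = proj (modes N) (Mult g (proj {..<0} (u - PN N u)))"
    by (simp only: AN.diff u\<^sub>N(2) truncation_residual) (rule PN_eq_proj)
  then show ?thesis using l2_le_proj[OF l2_le_Mult[OF g_l1 l2_le_proj[OF R]]] by metis
qed

lemma weighted_error_le:
  assumes s: "0 \<le> s" "s \<le> t" and U: "l2_le (weighted t u) U" and "N \<ge> 1"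
    and stable: "l2_stable \<kappa> (ranPN N) (AN N g)"
    and u\<^sub>N: "u\<^sub>N \<in> ranPN N" "AN N g u\<^sub>N = PN N (g - one_c)"
  shows "l2_le (weighted s (u - u\<^sub>N))
    (((1 / 2) powr (s - t) + \<kappa> * l1_norm g * (1 / 2) powr - t) * U * real N powr (s - t))"
proof -
  have half: "(real N / 2) powr a = (1 / 2) powr a * real N powr a" for a
    using powr_mult[of "1 / 2" "real N" a] by simp
  define R where "R = (real N / 2) powr - t * U"
  have R: "l2_le (u - PN N u) R"
    using truncation_error[OF U, of 0 N] s \<open>N \<ge> 1\<close> by (simp add: weighted_0 R_def)
  have window: "u\<^sub>N - PN N u \<in> ranPN N"
    using u\<^sub>N(1) by (simp add: ranPN_eq PN_eq_proj proj_diff proj_proj)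
  have "l2_le (u\<^sub>N - PN N u) (\<kappa> * (l1_norm g * R))"
    by (rule l2_stableD[OF stable, OF window AN_truncation_defect[OF u\<^sub>N R]])
  then have "l2_le (weighted s (u\<^sub>N - PN N u)) (real N powr s * (\<kappa> * (l1_norm g * R)))"
    by (rule bernstein_inequality[OF _ window s(1) \<open>N \<ge> 1\<close>])
  moreover have "l2_le (weighted s (u - PN N u)) ((real N / 2) powr (s - t) * U)"
    by (rule truncation_error[OF U s(2) \<open>N \<ge> 1\<close>])
  moreover have "weighted s (u - u\<^sub>N) = weighted s (u - PN N u) - weighted s (u\<^sub>N - PN N u)"
    by (simp flip: weighted_diff)
  ultimately have "l2_le (weighted s (u - u\<^sub>N))
      ((real N / 2) powr (s - t) * U + real N powr s * (\<kappa> * (l1_norm g * R)))"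
    using l2_le_diff by metis
  also have "real N powr s * (\<kappa> * (l1_norm g * R)) =
      \<kappa> * l1_norm g * (1 / 2) powr - t * U * (real N powr s * real N powr - t)"
    by (simp only: half R_def mult_ac)
  also have "real N powr s * real N powr - t = real N powr (s - t)"
    by (simp add: powr_add[symmetric])
  also have "(real N / 2) powr (s - t) * U + \<kappa> * l1_norm g * (1 / 2) powr - t * U * real N powr (s - t) =
      ((1 / 2) powr (s - t) + \<kappa> * l1_norm g * (1 / 2) powr - t) * U * real N powr (s - t)"
    by (simp only: half distrib_left distrib_right mult_ac)
  finally show ?thesis .
qed

theorem finite_section_error:
  assumes s: "0 \<le> s" "s \<le> t" and u: "in_Hs t u" and c: "c \<bar>s\<bar> \<ge> 0"
  shows "\<exists>C. \<forall>\<^sub>F N in sequentially. bij_betw (AN N g) (ranPN N) (ranPN N) \<and>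
    (\<forall>u\<^sub>N\<in>ranPN N. AN N g u\<^sub>N = PN N (g - one_c) \<longrightarrow> Hs_norm c s (u - u\<^sub>N) \<le> C * real N powr (s - t))"
proof -
  obtain \<kappa> where stable: "\<forall>\<^sub>F N in sequentially. l2_stable \<kappa> (ranPN N) (AN N g)"
    using eventually_AN_stable by blast
  obtain U where U: "l2_le (weighted t u) U" using u by (auto simp: in_Hs_iff_l2_le)
  define C where "C = sqrt (c \<bar>s\<bar>) * (((1 / 2) powr (s - t) + \<kappa> * l1_norm g * (1 / 2) powr - t) * U)"
  have "\<forall>\<^sub>F N in sequentially. bij_betw (AN N g) (ranPN N) (ranPN N) \<and>
    (\<forall>u\<^sub>N\<in>ranPN N. AN N g u\<^sub>N = PN N (g - one_c) \<longrightarrow> Hs_norm c s (u - u\<^sub>N) \<le> C * real N powr (s - t))"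
    using stable eventually_ge_at_top[of 1]
  proof (eventually_elim, intro conjI ballI impI)
    fix N assume N: "l2_stable \<kappa> (ranPN N) (AN N g)" "1 \<le> N"
    show "bij_betw (AN N g) (ranPN N) (ranPN N)" by (rule bij_betw_AN[OF N(1)])
    show "Hs_norm c s (u - u\<^sub>N) \<le> C * real N powr (s - t)"
      if "u\<^sub>N \<in> ranPN N" "AN N g u\<^sub>N = PN N (g - one_c)" for u\<^sub>N
      using Hs_norm_le[OF weighted_error_le[OF s U N(2,1) that], of c] c by (simp add: C_def mult.assoc)
  qed
  then show ?thesis ..
qed

end

theorem theoremt:
  fixes c :: "real \<Rightarrow> real" and g u :: lcoef and t :: real
  assumes c_pos: "\<forall>r\<ge>0. c r > 0"
    and t: "t \<ge> 1"
    and gH: "in_Hs t g"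
    and gmin: "\<exists>\<delta>>0. \<forall>z. cmod z = 1 \<longrightarrow> cmod (lval g z) \<ge> \<delta>"
    and uH: "in_Hs t u"
    and usol: "RHP_sol g u"
    and uniq: "\<forall>v. RHP_sol g v \<longrightarrow> v = u"
  shows "\<forall>s. (s = 0 \<or> s > 1/2) \<and> 0 \<le> 2 * s \<and> 2 * s < t \<longrightarrow>
           (\<exists>Cst. \<exists>N0>0. \<forall>N::nat. real N > N0 \<longrightarrow>
              bij_betw (AN N g) (ranPN N) (ranPN N) \<and>
              (\<forall>uN \<in> ranPN N. AN N g uN = PN N (g - one_c) \<longrightarrow>
                  Hs_norm c s (u - uN) \<le> Cst * real N powr (s - t)))"
proof (intro allI impI)
  fix s assume "(s = 0 \<or> s > 1/2) \<and> 0 \<le> 2 * s \<and> 2 * s < t"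
  then have s: "0 \<le> s" "s \<le> t" by auto
  have "in_l1 g" "in_l1 u" using in_Hs_imp_in_l1[OF _ gH] in_Hs_imp_in_l1[OF _ uH] t by auto
  moreover obtain \<delta> where "\<delta> > 0" "\<And>z. cmod z = 1 \<Longrightarrow> \<delta> \<le> cmod (lval g z)" using gmin by blast
  ultimately interpret uniquely_solvable_RHP g \<delta> u
    by unfold_locales (simp_all add: usol uniq)
  have "c \<bar>s\<bar> \<ge> 0" using c_pos by (simp add: less_imp_le)
  then obtain C N\<^sub>0 where "\<And>N. N \<ge> N\<^sub>0 \<Longrightarrow> bij_betw (AN N g) (ranPN N) (ranPN N) \<and>
      (\<forall>uN\<in>ranPN N. AN N g uN = PN N (g - one_c) \<longrightarrow> Hs_norm c s (u - uN) \<le> C * real N powr (s - t))"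
    using finite_section_error[OF s uH, of c] unfolding eventually_sequentially by blast
  then show "\<exists>Cst. \<exists>N0>0. \<forall>N::nat. real N > N0 \<longrightarrow> bij_betw (AN N g) (ranPN N) (ranPN N) \<and>
      (\<forall>uN\<in>ranPN N. AN N g uN = PN N (g - one_c) \<longrightarrow> Hs_norm c s (u - uN) \<le> Cst * real N powr (s - t))"
    by (intro exI[of _ C] exI[of _ "real (Suc N\<^sub>0)"]) auto
qed

end
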